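(* Let $s\ge1$, let $u_1,\dots,u_s\in\mathfrak{h}_C^0\cup\{y\}$ with $u_j\neq y$ for at least one $j$, and let $k\in\mathbb{Z}_{\ge1}$. Then \[ \sum_{i=1}^{s}Z_{\mathrm{cyc}}\big(u_{1}\otimes\cdots\otimes u_{i-1}\otimes(z_{k}\,\underline{\ast}\, u_{i})\otimes u_{i+1}\otimes\cdots\otimes u_{s}\big) =\sum_{i=1}^{s}Z_{\mathrm{cyc}}\big(u_{1}\otimes\cdots\otimes u_{i}\otimes z_{k}\otimes u_{i+1}\otimes\cdots\otimes u_{s}\big), \] where $z_{k}\,\underline{\ast}\, u_{i}=z_{k}*u_{i}-z_{k}u_{i}-u_{i}z_{k}$.
   Context: Let $\mathfrak{h}=\mathbb{Q}\langle x,y\rangle$, $\mathfrak{h}_C:=\mathfrak{h}x\oplus\mathfrak{h}y$, $\mathfrak{h}^0:=\mathbb{Q}\oplus y\mathfrak{h}x$, $\mathfrak{h}^1:=\mathbb{Q}\oplus y\mathfrak{h}$, $\mathfrak{h}_C^0:=\mathfrak{h}^0\cap\mathfrak{h}_C$, $\mathfrak{h}_C^1:=\mathfrak{h}^1\cap\mathfrak{h}_C$, and $z_k:=yx^{k-1}$. The harmonic product $*$ on $\mathfrak{h}^1$ is the bilinear product given on words by \[ z_{k_{1}}\cdots z_{k_{r}}*z_{l_{1}}\cdots z_{l_{s}}:=\sum_{d=\max(r,s)}^{r+s}\sum_{(f,g)}z_{m_{1}}\cdots z_{m_{d}}, \] the inner sum over strictly increasing $f:\{1,\dots,r\}\to\{1,\dots,d\}$,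 $g:\{1,\dots,s\}\to\{1,\dots,d\}$ with $\mathrm{Im}f\cup\mathrm{Im}g=\{1,\dots,d\}$, where $m_i=k_{f^{-1}(i)}$ if $i\in\mathrm{Im}f\setminus\mathrm{Im}g$, $m_i=l_{g^{-1}(i)}$ if $i\in\mathrm{Im}g\setminus\mathrm{Im}f$, and $m_i=k_{f^{-1}(i)}+l_{g^{-1}(i)}$ if $i\in\mathrm{Im}f\cap\mathrm{Im}g$. The inner harmonic product $\underline{\ast}:\mathfrak{h}^1\times\mathfrak{h}^1_C\to\mathfrak{h}^1_C$ is defined by the same formula (with $s\ge1$) but the sum restricted additionally to pairs $(f,g)$ with $g(1)\le f(i)\le g(s)$ for all $i$. An index $(k_1,\dots,k_r)$ is admissible if $k_r\ge2$. A multi-index $\Bbbk=[(k_{1,1},\dots,k_{1,r_{1}}),\dots,(k_{s,1},\dots,k_{s,r_{s}})]$ of positive integers is an admissible cyclic index if each block is admissible or equal to $(1)$ and at least one block is not $(1)$; then $\zeta_{\mathrm{cyc}}(\Bbbk):=\sum_{(n_{i,j})\in S}\prod_{i,j}n_{i,j}^{-k_{i,j}}$ with $S=\{(n_{1,1},\dots,n_{s,r_s})\in\mathbb{Z}_{\ge1}^{r_1+\cdots+r_s}\mid n_{1,1}<\cdots<n_{1,r_{1}}\geq n_{2,1}<\cdots<n_{2,r_{2}}\geq\cdots\geq n_{s,1}<\cdots<n_{s,r_{s}}\geq n_{1,1}\}$. Let $\mathfrak{h}^{\mathrm{cyc}}\subset\bigoplus_{s\ge1}\mathfrak{h}^{\otimes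 s}$ be spanned by all $u_1\otimes\cdots\otimes u_s$ with $u_i\in\mathfrak{h}_C^0\cup\{y\}$ and some $u_j\ne y$, and let $Z_{\mathrm{cyc}}:\mathfrak{h}^{\mathrm{cyc}}\to\mathbb{R}$ be the $\mathbb{Q}$-linear map with $Z_{\mathrm{cyc}}(z_{k_{1,1}}\cdots z_{k_{1,r_{1}}}\otimes\cdots\otimes z_{k_{s,1}}\cdots z_{k_{s,r_{s}}})=\zeta_{\mathrm{cyc}}([(k_{1,1},\dots,k_{1,r_{1}}),\dots,(k_{s,1},\dots,k_{s,r_{s}})])$. *)

theory Defs
  imports "HOL-Analysis.Analysis" "HOL-Library.Poly_Mapping"
begin

section \<open>The free algebra on two letters\<close>

datatype letter = LX | LY

text \<open>Lists form the free monoid under concatenation, so that finitely supported functions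
  \<^typ>\<open>letter list \<Rightarrow>\<^sub>0 rat\<close> with the convolution product are the noncommutative polynomials
  over the rationals.\<close>

instantiation list :: (type) monoid_add
begin

definition zero_list :: "'a list" where "zero_list = []"

definition plus_list :: "'a list \<Rightarrow> 'a list \<Rightarrow> 'a list" where "plus_list = append"

instance by standard (simp_all add: zero_list_def plus_list_def)

end

type_synonym falg = "letter list \<Rightarrow>\<^sub>0 rat"

abbreviation scalar :: "rat \<Rightarrow> falg" where "scalar c \<equiv> Poly_Mapping.single 0 c"

definition xx :: falg where "xx = Poly_Mapping.single [LX] 1"

definition yy :: falg where "yy = Poly_Mapping.single [LY] 1"

definition zz :: "nat \<Rightarrow> falg" where "zz k = yy * xx ^ (k - 1)"

definition hC :: "falg set" where "hC = {a * xx + b * yy | a b. True}"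

definition h0 :: "falg set" where "h0 = {scalar c + yy * a * xx | c a. True}"

definition h1 :: "falg set" where "h1 = {scalar c + yy * a | c a. True}"

definition hC0 :: "falg set" where "hC0 = h0 \<inter> hC"

definition hC1 :: "falg set" where "hC1 = h1 \<inter> hC"

definition zword :: "nat list \<Rightarrow> letter list" where
  "zword ks = concat (map (\<lambda>k. LY # replicate (k - 1) LX) ks)"

text \<open>The words \<^term>\<open>zword ks\<close> with positive entries are exactly the empty word and the words
  starting with \<^term>\<open>LY\<close>, i.e. a basis of \<^term>\<open>h1\<close>; \<open>index_of\<close> is arbitrary on other words.\<close>

definition index_of :: "letter list \<Rightarrow> nat list" where
  "index_of = inv_into {ks. \<forall>k\<in>set ks. k \<ge> 1} zword"


section \<open>Harmonic products\<close>

text \<open>Positions are counted from 0.\<close>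

definition stuffles :: "nat \<Rightarrow> nat \<Rightarrow> nat \<Rightarrow> ((nat \<Rightarrow> nat) \<times> (nat \<Rightarrow> nat)) set" where
  "stuffles r s d = {(f, g). f \<in> {..<r} \<rightarrow>\<^sub>E {..<d} \<and> g \<in> {..<s} \<rightarrow>\<^sub>E {..<d}
     \<and> strict_mono_on {..<r} f \<and> strict_mono_on {..<s} g
     \<and> f ` {..<r} \<union> g ` {..<s} = {..<d}}"

definition inner_stuffles :: "nat \<Rightarrow> nat \<Rightarrow> nat \<Rightarrow> ((nat \<Rightarrow> nat) \<times> (nat \<Rightarrow> nat)) set" where
  "inner_stuffles r s d =
     {(f, g) \<in> stuffles r s d. \<forall>i<r. g 0 \<le> f i \<and> f i \<le> g (s - 1)}"

definition stuffle_entry ::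
  "nat list \<Rightarrow> nat list \<Rightarrow> (nat \<Rightarrow> nat) \<Rightarrow> (nat \<Rightarrow> nat) \<Rightarrow> nat \<Rightarrow> nat" where
  "stuffle_entry ks ls f g i =
     (let F = {..<length ks}; G = {..<length ls} in
      if i \<in> f ` F - g ` G then ks ! inv_into F f i
      else if i \<in> g ` G - f ` F then ls ! inv_into G g i
      else ks ! inv_into F f i + ls ! inv_into G g i)"

definition stuffle_sum ::
  "(nat \<Rightarrow> nat \<Rightarrow> nat \<Rightarrow> ((nat \<Rightarrow> nat) \<times> (nat \<Rightarrow> nat)) set) \<Rightarrow> nat list \<Rightarrow> nat list \<Rightarrow> falg" where
  "stuffle_sum P ks ls =
     (\<Sum>d = max (length ks) (length ls)..length ks + length ls.
        \<Sum>(f, g)\<in>P (length ks) (length ls) d.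
          Poly_Mapping.single (zword (map (stuffle_entry ks ls f g) [0..<d])) 1)"

definition bilinear_ext :: "(nat list \<Rightarrow> nat list \<Rightarrow> falg) \<Rightarrow> falg \<Rightarrow> falg \<Rightarrow> falg" where
  "bilinear_ext B a b =
     (\<Sum>v\<in>Poly_Mapping.keys a. \<Sum>w\<in>Poly_Mapping.keys b.
        scalar (Poly_Mapping.lookup a v * Poly_Mapping.lookup b w) * B (index_of v) (index_of w))"

text \<open>The products are meaningful on \<open>h1 \<times> h1\<close> and \<open>h1 \<times> hC1\<close> respectively.\<close>

definition harmonic :: "falg \<Rightarrow> falg \<Rightarrow> falg" where
  "harmonic = bilinear_ext (stuffle_sum stuffles)"

definition inner_harmonic :: "falg \<Rightarrow> falg \<Rightarrow> falg" where
  "inner_harmonic = bilinear_ext (stuffle_sum inner_stuffles)"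


section \<open>Cyclic multiple zeta values\<close>

text \<open>A multi-index is a list of nonempty blocks.  The successor of the last block is the first
  one, hence the index modulo the number of blocks.\<close>

definition cyc_domain :: "nat list list \<Rightarrow> nat list list set" where
  "cyc_domain kss = {nss. map length nss = map length kss
     \<and> (\<forall>ns\<in>set nss. (\<forall>n\<in>set ns. n \<ge> 1) \<and> sorted_wrt (<) ns)
     \<and> (\<forall>i<length nss. last (nss ! i) \<ge> hd (nss ! (Suc i mod length nss)))}"

definition zeta_cyc :: "nat list list \<Rightarrow> real" where
  "zeta_cyc kss = (\<Sum>\<^sub>\<infinity>nss\<in>cyc_domain kss.
     \<Prod>i<length kss. \<Prod>j<length (kss ! i). 1 / real (nss ! i ! j) ^ (kss ! i ! j))"

text \<open>The direct sum of the tensor powers of \<^typ>\<open>falg\<close> is the free vector space on the lists of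
  words (the list \<open>[w\<^sub>1, \<dots>, w\<^sub>s]\<close> stands for the basis tensor of these words).
  \<open>tensor [u\<^sub>1, \<dots>, u\<^sub>s]\<close> is the pure tensor of the \<open>u\<^sub>i\<close>.\<close>

type_synonym tens = "letter list list \<Rightarrow>\<^sub>0 rat"

lift_definition tensor :: "falg list \<Rightarrow> tens" is
  "\<lambda>us ws. if length ws = length us
     then \<Prod>i<length us. Poly_Mapping.lookup (us ! i) (ws ! i) else 0"
proof -
  fix us :: "falg list"
  let ?c = "\<lambda>ws. if length ws = length us
     then \<Prod>i<length us. Poly_Mapping.lookup (us ! i) (ws ! i) else 0"
  let ?K = "\<Union>u\<in>set us. Poly_Mapping.keys u"
  have "{ws. ?c ws \<noteq> 0} \<subseteq> {ws. set ws \<subseteq> ?K \<and> length ws = length us}"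
  proof safe
    fix ws w assume c: "?c ws \<noteq> 0" and w: "w \<in> set ws"
    have l: "length ws = length us"
      and p: "(\<Prod>i<length us. Poly_Mapping.lookup (us ! i) (ws ! i)) \<noteq> 0"
      using c by (auto split: if_splits)
    obtain i where i: "i < length us" "w = ws ! i"
      using w l by (auto simp: in_set_conv_nth)
    have "Poly_Mapping.lookup (us ! i) w \<noteq> 0"
      using p i by auto
    then show "w \<in> ?K"
      using i by (auto simp: in_keys_iff intro!: bexI[of _ "us ! i"])
  qed (auto split: if_splits)
  moreover have "finite {ws. set ws \<subseteq> ?K \<and> length ws = length us}"
    by (rule finite_lists_length_eq) auto
  ultimately show "finite {ws. ?c ws \<noteq> 0}"
    by (rule finite_subset)
qed

text \<open>The linear map that sends the basis tensor of \<open>zword ks\<^sub>1, \<dots>, zword ks\<^sub>s\<close> to the cyclic zeta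
  value of \<open>[ks\<^sub>1, \<dots>, ks\<^sub>s]\<close>; only its values on the span of the admissible tensors are
  meaningful.\<close>

definition Zcyc :: "tens \<Rightarrow> real" where
  "Zcyc t = (\<Sum>ws\<in>Poly_Mapping.keys t.
     of_rat (Poly_Mapping.lookup t ws) * zeta_cyc (map index_of ws))"


section \<open>Basic facts\<close>

lemma single_zword: "Poly_Mapping.single (zword ks) 1 = prod_list (map zz ks)"
proof -
  have p: "xx ^ n = Poly_Mapping.single (replicate n LX) 1" for n
    by (induction n) (auto simp: xx_def mult_single plus_list_def zero_list_def simp flip: single_one)
  have zs: "zz k = Poly_Mapping.single (LY # replicate (k - 1) LX) 1" for k
    by (simp add: zz_def p yy_def mult_single plus_list_def)
  show ?thesis
  proof (induction ks)
    case (Cons k ks)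
    then have "prod_list (map zz (k # ks)) = zz k * Poly_Mapping.single (zword ks) 1"
      by simp
    also have "\<dots> = Poly_Mapping.single (zword (k # ks)) 1"
      by (simp add: zs zword_def mult_single plus_list_def)
    finally show ?case ..
  qed (simp add: zword_def zero_list_def flip: single_one)
qed

lemma inj_on_zword: "inj_on zword {ks. \<forall>k\<in>set ks. k \<ge> 1}"
proof (rule inj_onI)
  fix ks ls
  assume "ks \<in> {ks. \<forall>k\<in>set ks. k \<ge> 1}" "ls \<in> {ks. \<forall>k\<in>set ks. k \<ge> 1}" "zword ks = zword ls"
  then show "ks = ls"
  proof (induction ks arbitrary: ls)
    case Nil
    then show ?case by (cases ls) (auto simp: zword_def)
  next
    case (Cons k ks)
    then obtain l ls' where ls: "ls = l # ls'" by (cases ls) (auto simp: zword_def)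
    have eq: "replicate (k - 1) LX @ zword ks = replicate (l - 1) LX @ zword ls'"
      using Cons.prems(3) by (simp add: ls zword_def)
    have t: "takeWhile (\<lambda>a. a = LX) (replicate n LX @ zword ms) = replicate n LX" for n ms
      by (induction n) (cases ms, auto simp: zword_def)
    have "replicate (k - 1) LX = replicate (l - 1) LX"
      using arg_cong[OF eq, of "takeWhile (\<lambda>a. a = LX)"] by (simp only: t)
    then have kl: "k - 1 = l - 1" by (metis length_replicate)
    then have "zword ks = zword ls'" using eq by simp
    then have "ks = ls'" using Cons ls by auto
    moreover have "k = l" using kl Cons.prems ls by auto
    ultimately show ?case by (simp add: ls)
  qed
qed

lemma index_of_zword: "\<forall>k\<in>set ks. k \<ge> 1 \<Longrightarrow> index_of (zword ks) = ks"
  unfolding index_of_def by (rule inv_into_f_f[OF inj_on_zword]) auto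

lemma harmonic_words:
  assumes "\<forall>k\<in>set ks. k \<ge> 1" "\<forall>l\<in>set ls. l \<ge> 1"
  shows "harmonic (prod_list (map zz ks)) (prod_list (map zz ls)) = stuffle_sum stuffles ks ls"
    and "inner_harmonic (prod_list (map zz ks)) (prod_list (map zz ls)) =
           stuffle_sum inner_stuffles ks ls"
  using assms
  by (simp_all add: harmonic_def inner_harmonic_def bilinear_ext_def index_of_zword
      flip: single_zword)

lemma tensor_words:
  "tensor (map (\<lambda>w. Poly_Mapping.single w 1) ws) = Poly_Mapping.single ws 1"
proof (rule poly_mapping_eqI)
  fix vs
  show "Poly_Mapping.lookup (tensor (map (\<lambda>w. Poly_Mapping.single w 1) ws)) vs =
        Poly_Mapping.lookup (Poly_Mapping.single ws 1) vs"
  proof (cases "vs = ws")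
    case False
    then have "length vs \<noteq> length ws \<or> (\<exists>i<length ws. ws ! i \<noteq> vs ! i)"
      by (metis nth_equalityI)
    then show ?thesis
      using False by (auto simp: tensor.rep_eq lookup_single when_def)
  qed (simp add: tensor.rep_eq)
qed

lemma Zcyc_words:
  assumes "\<forall>ks\<in>set kss. \<forall>k\<in>set ks. k \<ge> 1"
  shows "Zcyc (tensor (map (\<lambda>ks. prod_list (map zz ks)) kss)) = zeta_cyc kss"
proof -
  have "map (\<lambda>ks. prod_list (map zz ks)) kss =
        map (\<lambda>w. Poly_Mapping.single w 1) (map zword kss)"
    by (simp add: single_zword)
  then have "tensor (map (\<lambda>ks. prod_list (map zz ks)) kss) = Poly_Mapping.single (map zword kss) 1"
    by (simp only: tensor_words)
  moreover have "map index_of (map zword kss) = kss"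
    using assms by (simp add: index_of_zword map_idI)
  ultimately show ?thesis by (simp add: Zcyc_def del: map_map)
qed

end

theory Submission
  imports Defs
begin

text \<open>By multilinearity it suffices to treat words.  For words, both sides are the sum, over all
  points \<open>(n\<^sub>i\<^sub>j)\<close> of the domain of the cyclic zeta value of \<open>u\<^sub>1 \<otimes> \<dots> \<otimes> u\<^sub>s\<close> and all \<open>n \<ge> 1\<close>, of
  the summand divided by \<open>n\<^sup>k\<close>.  With \<open>first\<^sub>i\<close> and \<open>last\<^sub>i\<close> the ends of the \<open>i\<close>-th block, it is weighted on the left by the number of \<open>i\<close> with
  \<open>first\<^sub>i \<le> n \<le> last\<^sub>i\<close> and on the right by the number of \<open>i\<close> with
  \<open>first\<^sub>i\<^sub>+\<^sub>1 \<le> n \<le> last\<^sub>i\<close>.  As \<open>first\<^sub>i\<close> and \<open>first\<^sub>i\<^sub>+\<^sub>1\<close> are at most \<open>last\<^sub>i\<close>, the two indicators are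
  \<open>[n \<le> last\<^sub>i] - [n < first\<^sub>i]\<close> and \<open>[n \<le> last\<^sub>i] - [n < first\<^sub>i\<^sub>+\<^sub>1]\<close>, and their sums over the
  cycle agree.\<close>

section \<open>The harmonic product with a single letter\<close>

text \<open>Both maps list the same finite set in increasing order, and a strictly sorted list is
  determined by its set.\<close>

lemma strict_mono_on_image_unique:
  fixes g h :: "nat \<Rightarrow> nat"
  assumes "strict_mono_on {..<s} g" "strict_mono_on {..<s} h" "g ` {..<s} = h ` {..<s}" "i < s"
  shows "g i = h i"
proof -
  have sorted: "sorted_wrt (<) (map e [0..<s])" if "strict_mono_on {..<s} e" for e :: "nat \<Rightarrow> nat"
    using that by (auto simp: sorted_wrt_iff_nth_less strict_mono_on_def)
  have "map g [0..<s] = map h [0..<s]"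
    using assms(3) by (intro strict_sorted_equal sorted assms(1,2)) (simp add: lessThan_atLeast0)
  then show ?thesis using assms(4) by (simp add: map_eq_conv)
qed

text \<open>The coface map of the simplex category: the increasing enumeration of the naturals that
  misses \<open>j\<close>.\<close>

definition skip :: "nat \<Rightarrow> nat \<Rightarrow> nat" where
  "skip j i = (if i < j then i else Suc i)"

lemma skip_image: "j \<le> s \<Longrightarrow> skip j ` {..<s} = {..<Suc s} - {j}"
proof (intro equalityI subsetI)
  fix x assume "j \<le> s" "x \<in> {..<Suc s} - {j}"
  then have "x = skip j (if x < j then x else x - 1)" "(if x < j then x else x - 1) < s"
    by (auto simp: skip_def)
  then show "x \<in> skip j ` {..<s}" by blast
qed (auto simp: skip_def split: if_splits)

lemma strict_mono_skip: "strict_mono_on A (skip j)"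
  by (auto simp: strict_mono_on_def skip_def)

lemma strict_mono_on_restrict: "strict_mono_on A (restrict g A) = strict_mono_on A g"
  by (auto simp: strict_mono_on_def)

text \<open>The pairs \<open>(f, g)\<close> for a single letter: here it is merged with letter
  \<open>j\<close> of a word of length \<open>s\<close>, in \<open>insert_at\<close> it gets the
  position \<open>j\<close> for itself. The restrictions make both maps extensional, as the function
  spaces in \<open>stuffles\<close> demand.\<close>

definition contract_at :: "nat \<Rightarrow> nat \<Rightarrow> (nat \<Rightarrow> nat) \<times> (nat \<Rightarrow> nat)" where
  "contract_at s j = (restrict (\<lambda>_. j) {..<1}, restrict id {..<s})"

definition insert_at :: "nat \<Rightarrow> nat \<Rightarrow> (nat \<Rightarrow> nat) \<times> (nat \<Rightarrow> nat)" where
  "insert_at s j = (restrict (\<lambda>_. j) {..<1}, restrict (skip j) {..<s})"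

lemma inj_contract_at: "inj_on (contract_at s) A"
  by (auto simp: inj_on_def contract_at_def fun_eq_iff restrict_def split: if_splits)

lemma inj_insert_at: "inj_on (insert_at s) A"
  by (auto simp: inj_on_def insert_at_def fun_eq_iff restrict_def split: if_splits)

text \<open>An increasing map of \<open>{..<s}\<close> into itself is injective, hence onto, hence
  the identity. Only the value \<open>f 0\<close> is free.\<close>

lemma stuffles_one_contract:
  "stuffles 1 s s = contract_at s ` {..<s}"
proof (intro equalityI subsetI)
  fix p assume p: "p \<in> stuffles 1 s s"
  then obtain f g where fg: "p = (f, g)" and f: "f \<in> {..<1} \<rightarrow>\<^sub>E {..<s}"
    and g: "g \<in> {..<s} \<rightarrow>\<^sub>E {..<s}" and mono: "strict_mono_on {..<s} g"
    by (auto simp: stuffles_def)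
  have "inj_on g {..<s}" using mono by (rule strict_mono_on_imp_inj_on)
  then have "g ` {..<s} = {..<s}"
    using g by (intro card_subset_eq) (auto simp: card_image)
  then have "g i = id i" if "i < s" for i
    using that by (intro strict_mono_on_image_unique[OF mono]) (auto simp: strict_mono_on_def)
  then have "g = restrict id {..<s}"
    using g by (intro ext) (auto simp: restrict_def PiE_iff extensional_def)
  moreover have "f = restrict (\<lambda>_. f 0) {..<1}" "f 0 < s"
    using f by (auto simp: restrict_def PiE_iff extensional_def fun_eq_iff)
  ultimately show "p \<in> contract_at s ` {..<s}"
    using fg by (intro image_eqI[of _ _ "f 0"]) (auto simp: contract_at_def)
next
  fix p assume "p \<in> contract_at s ` {..<s}"
  then obtain j where j: "j < s" "p = (restrict (\<lambda>_. j) {..<1}, restrict id {..<s})"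
    by (auto simp: contract_at_def)
  have "strict_mono_on {..<1} (\<lambda>_::nat. j)" "strict_mono_on {..<s} id"
    by (auto simp: strict_mono_on_def)
  then show "p \<in> stuffles 1 s s"
    using j by (auto simp: stuffles_def strict_mono_on_restrict)
qed

text \<open>The \<open>s\<close> values of \<open>g\<close> leave one of the \<open>s + 1\<close>
  positions uncovered; \<open>f 0\<close> must fill it, and then \<open>g\<close> is forced to be
  the enumeration of the rest.\<close>

lemma stuffles_one_insert:
  "stuffles 1 s (Suc s) = insert_at s ` {..s}"
proof (intro equalityI subsetI)
  fix p assume p: "p \<in> stuffles 1 s (Suc s)"
  obtain f g where fg: "p = (f, g)" by (cases p)
  have f: "f \<in> {..<1} \<rightarrow>\<^sub>E {..<Suc s}" and g: "g \<in> {..<s} \<rightarrow>\<^sub>E {..<Suc s}"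
    and mono: "strict_mono_on {..<s} g" and un: "f ` {..<1} \<union> g ` {..<s} = {..<Suc s}"
    using p unfolding fg stuffles_def by blast+
  have f0: "f ` {..<1} = {f 0}" by auto
  have "inj_on g {..<s}" using mono by (rule strict_mono_on_imp_inj_on)
  then have "card (g ` {..<s}) = s" by (simp add: card_image)
  moreover have ins: "insert (f 0) (g ` {..<s}) = {..<Suc s}" using un f0 by simp
  \<comment> \<open>Otherwise the union of the images would have only \<open>s\<close>
    elements.\<close>
  ultimately have nin: "f 0 \<notin> g ` {..<s}"
    by (metis card_lessThan insert_absorb n_not_Suc_n)
  have im: "g ` {..<s} = {..<Suc s} - {f 0}"
    using Diff_insert_absorb[OF nin] unfolding ins by (rule sym)
  have f0s: "f 0 \<le> s" using PiE_mem[OF f, of 0] by simp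
  have "g i = skip (f 0) i" if "i < s" for i
    using that im skip_image[OF f0s]
    by (intro strict_mono_on_image_unique[OF mono strict_mono_skip]) auto
  then have "g = restrict (skip (f 0)) {..<s}"
    using g by (intro ext) (auto simp: restrict_def PiE_iff extensional_def)
  moreover have "f = restrict (\<lambda>_. f 0) {..<1}"
    using f by (auto simp: restrict_def PiE_iff extensional_def fun_eq_iff)
  ultimately show "p \<in> insert_at s ` {..s}"
    using fg f0s by (intro image_eqI[of _ _ "f 0"]) (auto simp: insert_at_def)
next
  fix p assume "p \<in> insert_at s ` {..s}"
  then obtain j where j: "j \<le> s" "p = (restrict (\<lambda>_. j) {..<1::nat}, restrict (skip j) {..<s})"
    by (auto simp: insert_at_def)
  have "skip j ` {..<s} \<subseteq> {..<Suc s}" using skip_image[OF j(1)] by auto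
  moreover have "strict_mono_on {..<1} (\<lambda>_::nat. j)" by (auto simp: strict_mono_on_def)
  moreover have "{j} \<union> skip j ` {..<s} = {..<Suc s}"
    using skip_image[OF j(1)] j(1) by auto
  moreover have "restrict (\<lambda>_. j) {..<1} ` {..<1::nat} = {j}" by auto
  ultimately show "p \<in> stuffles 1 s (Suc s)"
    using j strict_mono_skip[of "{..<s}" j]
    by (simp add: stuffles_def strict_mono_on_restrict restrict_PiE_iff subset_iff image_subset_iff
        del: One_nat_def)
qed

section \<open>The words in the product of one letter with a word\<close>

lemma stuffle_entry_contract:
  assumes "j < length ls"
  shows "map (stuffle_entry [k] ls (restrict (\<lambda>_. j) {..<1}) (restrict id {..<length ls})) [0..<length ls]
       = ls[j := ls ! j + k]"
proof (rule nth_equalityI)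
  fix i assume "i < length (map (stuffle_entry [k] ls (restrict (\<lambda>_. j) {..<1})
      (restrict id {..<length ls})) [0..<length ls])"
  then have i: "i < length ls" by simp
  have 1: "inv_into {..<length ls} (restrict id {..<length ls}) i = i"
    using i by (intro inv_into_f_eq) (auto simp: inj_on_def)
  have 2: "inv_into {..<1::nat} (restrict (\<lambda>_. j) {..<1}) j = 0"
    by (intro inv_into_f_eq) (auto simp: inj_on_def)
  have 3: "restrict (\<lambda>_. j) {..<1} ` {..<length [k]} = {j}"
    "restrict id {..<length ls} ` {..<length ls} = {..<length ls}" by auto
  have "map (stuffle_entry [k] ls (restrict (\<lambda>_. j) {..<1}) (restrict id {..<length ls}))
      [0..<length ls] ! i =
      stuffle_entry [k] ls (restrict (\<lambda>_. j) {..<1}) (restrict id {..<length ls}) i"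
    using i by simp
  also have "\<dots> = (if i = j then k + ls ! i else ls ! i)"
    using i assms 1 2 unfolding stuffle_entry_def Let_def 3 by auto
  also have "\<dots> = ls[j := ls ! j + k] ! i"
    using i by (simp add: nth_list_update)
  finally show "map (stuffle_entry [k] ls (restrict (\<lambda>_. j) {..<1}) (restrict id {..<length ls}))
      [0..<length ls] ! i = ls[j := ls ! j + k] ! i" .
qed simp

lemma stuffle_entry_insert:
  assumes "j \<le> length ls"
  shows "map (stuffle_entry [k] ls (restrict (\<lambda>_. j) {..<1}) (restrict (skip j) {..<length ls}))
           [0..<Suc (length ls)]
       = take j ls @ k # drop j ls"
proof (rule nth_equalityI)
  let ?g = "restrict (skip j) {..<length ls}"
  let ?l = "map (stuffle_entry [k] ls (restrict (\<lambda>_. j) {..<1}) ?g) [0..<Suc (length ls)]"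
  fix i assume "i < length ?l"
  then have i: "i < Suc (length ls)" by (simp del: upt_Suc)
  \<comment> \<open>The inverse of \<open>skip j\<close> moves the positions after \<open>j\<close>
    down by one.\<close>
  have 1: "inv_into {..<length ls} ?g i = (if i < j then i else i - 1)" if "i \<noteq> j"
    using i that assms by (intro inv_into_f_eq) (auto simp: inj_on_def skip_def split: if_splits)
  have 2: "inv_into {..<1::nat} (restrict (\<lambda>_. j) {..<1}) j = 0"
    by (intro inv_into_f_eq) (auto simp: inj_on_def)
  have 3: "restrict (\<lambda>_. j) {..<1} ` {..<length [k]} = {j}" by auto
  have 4: "?g ` {..<length ls} = {..<Suc (length ls)} - {j}"
    using skip_image[OF assms] by simp
  have "?l ! i = stuffle_entry [k] ls (restrict (\<lambda>_. j) {..<1}) ?g i"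
    using i by (simp del: upt_Suc)
  also have "\<dots> = (if i = j then k else ls ! (if i < j then i else i - 1))"
    using i 1 2 unfolding stuffle_entry_def Let_def 3 4 by auto
  also have "\<dots> = (take j ls @ k # drop j ls) ! i"
    using i assms by (auto simp: nth_append nth_Cons split: nat.splits intro!: arg_cong[of _ _ "(!) ls"])
  finally show "?l ! i = (take j ls @ k # drop j ls) ! i" .
qed (use assms in \<open>simp del: upt_Suc\<close>)

text \<open>A single letter either overlaps a letter of \<open>ls\<close> or does not, so only
  \<open>d = s\<close> and \<open>d = s + 1\<close> occur. Abstracting over \<open>P\<close> serves
  both products at once; they differ only in the set \<open>J\<close> of permitted insertion
  positions.\<close>

lemma stuffle_sum_single:
  assumes "ls \<noteq> []"
    and contract: "P 1 (length ls) (length ls) =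
      contract_at (length ls) ` {..<length ls}"
    and insert: "P 1 (length ls) (Suc (length ls)) =
      insert_at (length ls) ` J"
    and "J \<subseteq> {..length ls}"
  shows "stuffle_sum P [k] ls =
    (\<Sum>j<length ls. Poly_Mapping.single (zword (ls[j := ls ! j + k])) 1) +
    (\<Sum>j\<in>J. Poly_Mapping.single (zword (take j ls @ k # drop j ls)) 1)"
proof -
  let ?s = "length ls"
  let ?T = "\<lambda>d. \<Sum>(f, g)\<in>P 1 ?s d. Poly_Mapping.single (zword (map (stuffle_entry [k] ls f g) [0..<d])) (1::rat)"
  have "max 1 ?s = ?s" using assms(1) by (cases ls) auto
  then have "stuffle_sum P [k] ls = (\<Sum>d\<in>{?s..Suc ?s}. ?T d)"
    by (simp add: stuffle_sum_def del: upt_Suc)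
  also have "{?s..Suc ?s} = {?s, Suc ?s}" by auto
  also have "(\<Sum>d\<in>{?s, Suc ?s}. ?T d) = ?T ?s + ?T (Suc ?s)" by (simp del: upt_Suc)
  also have "?T ?s = (\<Sum>j<?s. Poly_Mapping.single (zword (ls[j := ls ! j + k])) 1)"
    unfolding contract
    by (subst sum.reindex[OF inj_contract_at])
      (simp add: contract_at_def stuffle_entry_contract del: One_nat_def)
  also have "?T (Suc ?s) = (\<Sum>j\<in>J. Poly_Mapping.single (zword (take j ls @ k # drop j ls)) 1)"
    unfolding insert using assms(4)
    by (subst sum.reindex[OF inj_insert_at])
      (auto intro!: sum.cong simp: insert_at_def stuffle_entry_insert subset_iff simp del: upt_Suc One_nat_def)
  finally show ?thesis .
qed

lemma stuffle_sum_stuffles: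
  assumes "ls \<noteq> []"
  shows "stuffle_sum stuffles [k] ls =
    (\<Sum>j<length ls. Poly_Mapping.single (zword (ls[j := ls ! j + k])) 1) +
    (\<Sum>j\<le>length ls. Poly_Mapping.single (zword (take j ls @ k # drop j ls)) 1)"
  using assms stuffles_one_contract stuffles_one_insert by (intro stuffle_sum_single) auto

lemma stuffle_sum_inner_stuffles:
  assumes "ls \<noteq> []"
  shows "stuffle_sum inner_stuffles [k] ls =
    (\<Sum>j<length ls. Poly_Mapping.single (zword (ls[j := ls ! j + k])) 1) +
    (\<Sum>j\<in>{1..<length ls}. Poly_Mapping.single (zword (take j ls @ k # drop j ls)) 1)"
proof (rule stuffle_sum_single[OF assms])
  let ?s = "length ls"
  have s: "?s \<ge> 1" using assms by (cases ls) auto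
  have inner: "inner_stuffles 1 ?s d =
      {p \<in> stuffles 1 ?s d. snd p 0 \<le> fst p 0 \<and> fst p 0 \<le> snd p (?s - 1)}" for d
    by (auto simp: inner_stuffles_def)
  have "{j\<in>{..<?s}. snd (contract_at ?s j) 0 \<le> fst (contract_at ?s j) 0 \<and>
      fst (contract_at ?s j) 0 \<le> snd (contract_at ?s j) (?s - 1)} = {..<?s}"
    using s by (auto simp: contract_at_def)
  then show "inner_stuffles 1 ?s ?s = contract_at ?s ` {..<?s}"
    unfolding inner stuffles_one_contract Compr_image_eq by simp
  have "{j\<in>{..?s}. snd (insert_at ?s j) 0 \<le> fst (insert_at ?s j) 0 \<and>
      fst (insert_at ?s j) 0 \<le> snd (insert_at ?s j) (?s - 1)} =
      {j\<in>{..?s}. skip j 0 \<le> j \<and> j \<le> skip j (?s - 1)}"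
    using s assms by (simp add: insert_at_def)
  \<comment> \<open>At \<open>j = 0\<close> the first letter of the word sits at
    \<open>skip 0 0 = 1\<close>, after the inserted one; at \<open>j = ?s\<close> the last letter
    sits at \<open>?s - 1\<close>, before it. All other positions are inside.\<close>
  also have "\<dots> = {1..<?s}"
    using s by (auto simp: skip_def split: if_splits)
  finally show "inner_stuffles 1 ?s (Suc ?s) = insert_at ?s ` {1..<?s}"
    unfolding inner stuffles_one_insert Compr_image_eq by simp
qed auto

text \<open>The terms lost by the inner product are the insertions at the two extreme positions
  \<open>0\<close> and \<open>length ls\<close>.\<close>

lemma stuffle_sum_inner_eq:
  assumes "ls \<noteq> []"
  shows "stuffle_sum inner_stuffles [k] ls = stuffle_sum stuffles [k] ls
     - Poly_Mapping.single (zword (k # ls)) 1 - Poly_Mapping.single (zword (ls @ [k])) 1"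
proof -
  let ?f = "\<lambda>j. Poly_Mapping.single (zword (take j ls @ k # drop j ls)) (1::rat)"
  have "sum ?f {..length ls} = sum ?f (insert 0 (insert (length ls) {1..<length ls}))"
    by (rule sum.cong) auto
  also have "\<dots> = ?f 0 + sum ?f (insert (length ls) {1..<length ls})"
    using assms by (intro sum.insert) auto
  also have "sum ?f (insert (length ls) {1..<length ls}) = ?f (length ls) + sum ?f {1..<length ls}"
    by (intro sum.insert) auto
  finally show ?thesis
    unfolding stuffle_sum_stuffles[OF assms] stuffle_sum_inner_stuffles[OF assms] by simp
qed

section \<open>Convergence of cyclic zeta values\<close>

text \<open>The summand of \<open>zeta_cyc\<close> is written with products of lists, here and in
  \<open>cyc_weight\<close>, because these split along \<open>@\<close> and
  \<open>#\<close>.\<close>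

definition block_weight :: "nat list \<Rightarrow> nat list \<Rightarrow> real" where
  "block_weight ks ns = prod_list (map2 (\<lambda>k n. 1 / real n ^ k) ks ns)"

definition cyc_weight :: "nat list list \<Rightarrow> nat list list \<Rightarrow> real" where
  "cyc_weight kss nss = prod_list (map2 block_weight kss nss)"

definition pos_sorted :: "nat list \<Rightarrow> bool" where
  "pos_sorted ns \<longleftrightarrow> (\<forall>n\<in>set ns. n \<ge> 1) \<and> sorted_wrt (<) ns"

definition cyc_admissible :: "nat list list \<Rightarrow> bool" where
  "cyc_admissible kss \<longleftrightarrow>
     (\<forall>ks\<in>set kss. ks \<noteq> [] \<and> (\<forall>k\<in>set ks. k \<ge> 1) \<and> (ks = [1] \<or> last ks \<ge> 2)) \<and>
     (\<exists>ks\<in>set kss. ks \<noteq> [1])"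

lemma prod_list_map2:
  "length xs = length ys \<Longrightarrow> prod_list (map2 f xs ys) = (\<Prod>i<length xs. f (xs ! i) (ys ! i))"
  by (simp add: prod.list_conv_set_nth lessThan_atLeast0)

lemma cyc_domain_iff:
  "nss \<in> cyc_domain kss \<longleftrightarrow> map length nss = map length kss \<and> (\<forall>i<length kss. pos_sorted (nss ! i))
     \<and> (\<forall>i<length kss. hd (nss ! (Suc i mod length kss)) \<le> last (nss ! i))"
proof -
  have "length nss = length kss" if "map length nss = map length kss"
    using that by (metis length_map)
  then show ?thesis by (auto simp: cyc_domain_def pos_sorted_def all_set_conv_all_nth)
qed

lemma cyc_domain_lengths:
  assumes "nss \<in> cyc_domain kss"
  shows "length nss = length kss" "i < length kss \<Longrightarrow> length (nss ! i) = length (kss ! i)"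
proof -
  have m: "map length nss = map length kss" using assms by (simp add: cyc_domain_iff)
  then show "length nss = length kss" by (metis length_map)
  then show "length (nss ! i) = length (kss ! i)" if "i < length kss"
    using m that by (metis nth_map)
qed

lemma zeta_cyc_eq_infsum: "zeta_cyc kss = infsum (cyc_weight kss) (cyc_domain kss)"
  unfolding zeta_cyc_def
  by (rule infsum_cong) (simp add: cyc_weight_def block_weight_def prod_list_map2 cyc_domain_lengths)

lemma block_weight_nonneg: "block_weight ks ns \<ge> 0"
  unfolding block_weight_def by (intro prod_list_nonneg) (auto simp: in_set_zip)

lemma cyc_weight_nonneg: "cyc_weight kss nss \<ge> 0"
  unfolding cyc_weight_def by (intro prod_list_nonneg) (auto simp: in_set_zip block_weight_nonneg)

lemma block_weight_append:
  "length ks = length ns \<Longrightarrow> block_weight (ks @ ks') (ns @ ns') = block_weight ks ns * block_weight ks' ns'"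
  by (simp add: block_weight_def)

lemma block_weight_Cons: "block_weight (k # ks) (n # ns) = block_weight ks ns / real n ^ k"
  by (simp add: block_weight_def)

lemma cyc_weight_append:
  "length ks = length ns \<Longrightarrow> cyc_weight (ks @ ks') (ns @ ns') = cyc_weight ks ns * cyc_weight ks' ns'"
  by (simp add: cyc_weight_def)

lemma cyc_weight_Cons: "cyc_weight (ks # kss) (ns # nss) = block_weight ks ns * cyc_weight kss nss"
  by (simp add: cyc_weight_def)

text \<open>Stated without division because \<open>block_weight\<close> can vanish: an entry 0 with
  a positive exponent contributes \<open>1 / 0 = 0\<close>.\<close>

lemma cyc_weight_update:
  assumes "i < length kss" "length nss = length kss"
  shows "cyc_weight (kss[i := ks]) (nss[i := ns]) * block_weight (kss ! i) (nss ! i) =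
    cyc_weight kss nss * block_weight ks ns"
  using assms
proof (induction kss arbitrary: i nss)
  case (Cons x xs)
  then obtain y ys where nss: "nss = y # ys" by (cases nss) auto
  show ?case
  proof (cases i)
    case (Suc j)
    then show ?thesis using Cons nss by (simp add: cyc_weight_Cons mult.assoc)
  qed (simp add: nss cyc_weight_Cons)
qed simp

text \<open>A list of length \<open>T + 1\<close> is a pair of head and tail, and the sum over such
  pairs of nonnegative terms is iterated: the inner sum is the constant for length \<open>T\<close>
  times \<open>g n\<close>.\<close>

lemma summable_on_lists_prod:
  fixes g :: "'a \<Rightarrow> real"
  assumes "g summable_on UNIV" "\<And>n. g n \<ge> 0"
  shows "(\<lambda>ns. prod_list (map g ns)) summable_on {ns. length ns = T}"
proof (induction T)
  case (Suc T)
  let ?p = "\<lambda>ns. prod_list (map g ns)"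
  have "(\<lambda>(n, ns). ?p (n # ns)) summable_on (SIGMA n:UNIV. {ns. length ns = T})"
  proof (rule summable_on_SigmaI)
    show "((\<lambda>ns. (\<lambda>(n, ns). ?p (n # ns)) (n, ns)) has_sum (g n * infsum ?p {ns. length ns = T}))
        {ns. length ns = T}" for n
      using has_sum_cmult_right[OF has_sum_infsum[OF Suc]] by simp
    show "(\<lambda>n. g n * infsum ?p {ns. length ns = T}) summable_on UNIV"
      using assms(1) by (rule summable_on_cmult_left)
  qed (auto intro!: mult_nonneg_nonneg prod_list_nonneg assms(2))
  then show ?case
    by (subst summable_on_reindex_bij_witness[where i = "\<lambda>(n, ns). n # ns"
          and j = "\<lambda>ns. (hd ns, tl ns)" and T = "SIGMA n:UNIV. {ns. length ns = T}"
          and h = "\<lambda>(n, ns). ?p (n # ns)"]) (auto simp: length_Suc_conv)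
qed simp

text \<open>Known block lengths say where to cut the concatenation. This lets a sum over
  multi-blocks be compared with one over flat lists.\<close>

lemma inj_on_concat_lengths: "inj_on concat {nss. map length nss = L}"
proof (induction L)
  case (Cons l L)
  show ?case
  proof (rule inj_onI)
    fix xss yss :: "'a list list"
    assume "xss \<in> {nss. map length nss = l # L}" "yss \<in> {nss. map length nss = l # L}"
      and eq: "concat xss = concat yss"
    then obtain xs xss' ys yss' where "xss = xs # xss'" "yss = ys # yss'"
      "length xs = l" "length ys = l" "map length xss' = L" "map length yss' = L"
      by (auto simp: map_eq_Cons_conv)
    then show "xss = yss" using eq Cons.IH by (auto dest: inj_onD)
  qed
qed auto

section \<open>Bounds for the weights and absolute convergence\<close>

lemma block_weight_le:
  assumes "length ns = length ks" "\<forall>n\<in>set ns. n \<ge> 1" "\<forall>k\<in>set ks. k \<ge> 1"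
  shows "block_weight ks ns \<le> prod_list (map (\<lambda>n. 1 / real n) ns)"
  using assms
proof (induction ns ks rule: list_induct2)
  case (Cons n ns k ks)
  have "real n ^ 1 \<le> real n ^ k" using Cons.prems by (intro power_increasing) auto
  then have "1 / real n ^ k \<le> 1 / real n" using Cons.prems by (simp add: frac_le)
  then have "1 / real n ^ k * block_weight ks ns \<le> 1 / real n * prod_list (map (\<lambda>n. 1 / real n) ns)"
    using Cons by (intro mult_mono) (auto simp: block_weight_nonneg)
  then show ?case by (simp add: block_weight_Cons)
qed (simp add: block_weight_def)

text \<open>An exponent of at least 2 on the last entry leaves one reciprocal of that entry to
  spare.\<close>

lemma block_weight_le_last:
  assumes "length ns = length ks" "\<forall>n\<in>set ns. n \<ge> 1" "\<forall>k\<in>set ks. k \<ge> 1" "ks \<noteq> []" "last ks \<ge> 2"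
  shows "block_weight ks ns \<le> 1 / real (last ns) * prod_list (map (\<lambda>n. 1 / real n) ns)"
proof -
  obtain ks' k where ks: "ks = ks' @ [k]" using assms(4) by (cases ks rule: rev_cases) auto
  obtain ns' n where ns: "ns = ns' @ [n]" using assms(1,4) by (cases ns rule: rev_cases) auto
  have len: "length ns' = length ks'" using assms(1) ks ns by simp
  have n: "n \<ge> 1" and k: "k \<ge> 2" using assms ks ns by auto
  have "real n ^ 2 \<le> real n ^ k" using n k by (intro power_increasing) auto
  then have "1 / real n ^ k \<le> 1 / real n ^ 2" using n by (simp add: frac_le)
  moreover have "block_weight ks' ns' \<le> prod_list (map (\<lambda>n. 1 / real n) ns')"
    using assms ks ns len by (intro block_weight_le) auto
  ultimately have "block_weight ks' ns' * (1 / real n ^ k) \<le>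
      prod_list (map (\<lambda>n. 1 / real n) ns') * (1 / real n ^ 2)"
    by (intro mult_mono) (auto intro!: prod_list_nonneg)
  then show ?thesis
    by (simp add: ks ns len block_weight_append block_weight_Cons power2_eq_square)
      (simp add: block_weight_def)
qed

lemma cyc_weight_le:
  assumes "length nss = length kss"
    "\<And>i. i < length kss \<Longrightarrow> block_weight (kss ! i) (nss ! i) \<le> prod_list (map (\<lambda>n. 1 / real n) (nss ! i))"
  shows "cyc_weight kss nss \<le> prod_list (map (\<lambda>n. 1 / real n) (concat nss))"
  using assms
proof (induction nss kss rule: list_induct2)
  case (Cons ns nss ks kss)
  have "block_weight ks ns * cyc_weight kss nss \<le>
      prod_list (map (\<lambda>n. 1 / real n) ns) * prod_list (map (\<lambda>n. 1 / real n) (concat nss))"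
    using Cons.prems[of 0] Cons.prems[of "Suc _"] Cons.IH
    by (intro mult_mono) (auto simp: cyc_weight_nonneg intro!: prod_list_nonneg)
  then show ?case by (simp add: cyc_weight_Cons)
qed (simp add: cyc_weight_def)

text \<open>One block with the additional factor \<open>c\<close> suffices to gain \<open>c\<close>
  in the whole product, the other blocks being bounded by their reciprocals.\<close>

lemma cyc_weight_le_scaled:
  assumes "length nss = length kss"
    "\<And>i. i < length kss \<Longrightarrow> block_weight (kss ! i) (nss ! i) \<le> prod_list (map (\<lambda>n. 1 / real n) (nss ! i))"
    "i < length kss" "0 \<le> c" "block_weight (kss ! i) (nss ! i) \<le> c * prod_list (map (\<lambda>n. 1 / real n) (nss ! i))"
  shows "cyc_weight kss nss \<le> c * prod_list (map (\<lambda>n. 1 / real n) (concat nss))"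
  using assms
proof (induction nss kss arbitrary: i rule: list_induct2)
  case (Cons ns nss ks kss)
  let ?P = "\<lambda>ns. prod_list (map (\<lambda>n. 1 / real n) ns)"
  have nonneg: "0 \<le> ?P ns" for ns by (intro prod_list_nonneg) auto
  have tl: "block_weight (kss ! j) (nss ! j) \<le> ?P (nss ! j)" if "j < length kss" for j
    using Cons.prems(1)[of "Suc j"] that by simp
  have hd: "block_weight ks ns \<le> ?P ns" using Cons.prems(1)[of 0] by simp
  have "block_weight ks ns * cyc_weight kss nss \<le> c * (?P ns * ?P (concat nss))"
  proof (cases i)
    case 0
    have "cyc_weight kss nss \<le> ?P (concat nss)" using Cons.hyps tl by (rule cyc_weight_le)
    then have "block_weight ks ns * cyc_weight kss nss \<le> (c * ?P ns) * ?P (concat nss)"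
      using Cons.prems 0 by (intro mult_mono) (auto simp: cyc_weight_nonneg nonneg)
    then show ?thesis by (simp add: mult.assoc)
  next
    case (Suc j)
    then have "cyc_weight kss nss \<le> c * ?P (concat nss)"
      using Cons.prems tl by (intro Cons.IH[of j]) auto
    then have "block_weight ks ns * cyc_weight kss nss \<le> ?P ns * (c * ?P (concat nss))"
      using hd by (intro mult_mono) (auto simp: cyc_weight_nonneg nonneg)
    then show ?thesis by (simp add: mult.left_commute)
  qed
  then show ?case by (simp add: cyc_weight_Cons)
qed simp

lemma pos_sorted_le_last:
  "pos_sorted ns \<Longrightarrow> n \<in> set ns \<Longrightarrow> n \<le> last ns"
  by (cases ns rule: rev_cases) (auto simp: pos_sorted_def sorted_wrt_append less_imp_le)

text \<open>Going around the cycle, the value of a block \<open>(1)\<close> is at most the last value of the block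
  before it, so that the maximum of all values occurs in a block other than \<open>(1)\<close>.\<close>

lemma cyc_domain_maximum:
  assumes adm: "cyc_admissible kss" and nss: "nss \<in> cyc_domain kss"
  obtains i where "i < length kss" "kss ! i \<noteq> [1]" "\<forall>n\<in>set (concat nss). n \<le> last (nss ! i)"
proof -
  let ?s = "length kss"
  define J where "J = {i. i < ?s \<and> kss ! i \<noteq> [1]}"
  define N where "N = Max ((\<lambda>i. last (nss ! i)) ` J)"
  obtain i1 where i1: "i1 \<in> J"
    using adm by (auto simp: cyc_admissible_def J_def in_set_conv_nth)
  then have s: "?s > 0" by (auto simp: J_def)
  have fin: "finite ((\<lambda>i. last (nss ! i)) ` J)" by (simp add: J_def)
  then have "N \<in> (\<lambda>i. last (nss ! i)) ` J"
    unfolding N_def using i1 by (intro Max_in) auto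
  then obtain i where i: "i \<in> J" "N = last (nss ! i)" by auto
  have le: "last (nss ! j) \<le> N" if "j \<in> J" for j
    unfolding N_def using that fin by (intro Max_ge) auto
  have around: "last (nss ! ((i1 + m) mod ?s)) \<le> N" for m
  proof (induction m)
    case 0
    then show ?case using i1 le by (simp add: J_def)
  next
    case (Suc m)
    let ?t = "(i1 + m) mod ?s" and ?u = "(i1 + Suc m) mod ?s"
    have u: "?u = Suc ?t mod ?s" by (simp add: mod_Suc_eq)
    show ?case
    proof (cases "?u \<in> J")
      case False
      then have "kss ! ?u = [1]" using s by (simp add: J_def)
      then have "length (nss ! ?u) = 1"
        using cyc_domain_lengths(2)[OF nss, of ?u] s by simp
      then have "last (nss ! ?u) = hd (nss ! ?u)" by (auto simp: length_Suc_conv)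
      also have "\<dots> \<le> last (nss ! ?t)"
        using nss s unfolding u cyc_domain_iff by auto
      finally show ?thesis using Suc by simp
    qed (rule le)
  qed
  have "n \<le> last (nss ! i)" if n: "n \<in> set (concat nss)" for n
  proof -
    obtain ns where ns: "ns \<in> set nss" "n \<in> set ns" using n by auto
    then obtain t where t: "t < ?s" "ns = nss ! t"
      using cyc_domain_lengths(1)[OF nss] by (auto simp: in_set_conv_nth)
    \<comment> \<open>Every block is reached from \<open>i1\<close>; the summand \<open>?s\<close>
      keeps the subtraction of naturals from truncating.\<close>
    have "(i1 + (t + ?s - i1)) mod ?s = t" using t i1 by (simp add: J_def)
    then have "last (nss ! t) \<le> N" using around[of "t + ?s - i1"] by simp
    moreover have "n \<le> last (nss ! t)"
      using ns t nss by (auto simp: cyc_domain_iff intro: pos_sorted_le_last)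
    ultimately show ?thesis using i by simp
  qed
  then show thesis using i by (intro that[of i]) (auto simp: J_def)
qed

lemma prod_list_map_mult:
  fixes f g :: "'a \<Rightarrow> 'b::comm_monoid_mult"
  shows "prod_list (map (\<lambda>x. f x * g x) xs) = prod_list (map f xs) * prod_list (map g xs)"
  by (induction xs) (simp_all add: ac_simps)

text \<open>Each factor is at least \<open>M powr (- e)\<close>, since negative powers decrease.
  With \<open>T\<close> entries and \<open>e = 1 / T\<close> the left side is
  \<open>1 / M\<close>.\<close>

lemma inverse_max_le_prod_powr:
  assumes "\<forall>n\<in>set ns. 1 \<le> n \<and> n \<le> M" "e \<ge> (0::real)" "M \<ge> (1::nat)"
  shows "real M powr (- e * real (length ns)) \<le> prod_list (map (\<lambda>n. real n powr (- e)) ns)"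
  using assms
proof (induction ns)
  case (Cons n ns)
  have "real M powr (- e * real (length (n # ns))) = real M powr (- e) * real M powr (- e * real (length ns))"
    by (simp add: powr_add[symmetric] algebra_simps)
  also have "\<dots> \<le> real n powr (- e) * prod_list (map (\<lambda>n. real n powr (- e)) ns)"
    using Cons by (intro mult_mono powr_mono2') auto
  finally show ?case by simp
qed simp

text \<open>With \<open>T\<close> variables of maximum \<open>M\<close>, the extra factor \<open>1 / M\<close> of an admissible block is
  distributed as a factor \<open>M powr (- 1 / T)\<close> to each variable.\<close>

lemma cyc_weight_le_powr:
  assumes adm: "cyc_admissible kss" and nss: "nss \<in> cyc_domain kss"
  shows "cyc_weight kss nss \<le>
    prod_list (map (\<lambda>n. real n powr (- 1 - 1 / real (sum_list (map length kss)))) (concat nss))"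
proof -
  define T where "T = sum_list (map length kss)"
  let ?P = "\<lambda>ns. prod_list (map (\<lambda>n. 1 / real n) ns)"
  note len = cyc_domain_lengths[OF nss]
  obtain i where i: "i < length kss" "kss ! i \<noteq> [1]" "\<forall>n\<in>set (concat nss). n \<le> last (nss ! i)"
    using cyc_domain_maximum[OF adm nss] .
  let ?M = "last (nss ! i)"
  have T: "length (concat nss) = T"
    using nss by (simp add: T_def length_concat cyc_domain_iff)
  have pos: "\<forall>n\<in>set (nss ! j). n \<ge> 1" if "j < length kss" for j
    using nss that by (simp add: cyc_domain_iff pos_sorted_def)
  have kss: "kss ! j \<noteq> []" "\<forall>k\<in>set (kss ! j). k \<ge> 1" "kss ! j = [1] \<or> last (kss ! j) \<ge> 2"
    if "j < length kss" for j
    using adm that by (auto simp: cyc_admissible_def)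
  have ne: "nss ! i \<noteq> []" using len(2)[OF i(1)] kss(1)[OF i(1)] by auto
  then have M: "?M \<ge> 1" using pos[OF i(1)] by auto
  have "nss ! i \<in> set nss" using i(1) len(1) by simp
  then have "concat nss \<noteq> []" using ne by auto
  then have T0: "T > 0" using T by (cases "concat nss") auto
  have all_pos: "\<forall>n\<in>set (concat nss). 1 \<le> n"
  proof
    fix n assume "n \<in> set (concat nss)"
    then obtain ns where "ns \<in> set nss" "n \<in> set ns" by auto
    then show "1 \<le> n" using pos len(1) by (metis in_set_conv_nth)
  qed
  have "cyc_weight kss nss \<le> (1 / real ?M) * ?P (concat nss)"
  proof (rule cyc_weight_le_scaled[OF len(1) _ i(1)])
    show "block_weight (kss ! j) (nss ! j) \<le> ?P (nss ! j)" if "j < length kss" for j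
      using that len pos kss by (intro block_weight_le) auto
    show "block_weight (kss ! i) (nss ! i) \<le> 1 / real ?M * ?P (nss ! i)"
      using i len pos kss kss(3)[OF i(1)] by (intro block_weight_le_last) auto
  qed simp
  also have "\<dots> \<le> prod_list (map (\<lambda>n. real n powr (- (1 / real T))) (concat nss)) * ?P (concat nss)"
  proof (rule mult_right_mono)
    have "1 / real ?M = real ?M powr (- (1 / real T) * real (length (concat nss)))"
      using M T0 unfolding T by (simp add: powr_minus_divide)
    also have "\<dots> \<le> prod_list (map (\<lambda>n. real n powr (- (1 / real T))) (concat nss))"
      using i all_pos M by (intro inverse_max_le_prod_powr) auto
    finally show "1 / real ?M \<le> prod_list (map (\<lambda>n. real n powr (- (1 / real T))) (concat nss))" .
  qed (auto intro!: prod_list_nonneg)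
  also have "prod_list (map (\<lambda>n. real n powr (- (1 / real T))) (concat nss)) * ?P (concat nss)
      = prod_list (map (\<lambda>n. real n powr (- (1 / real T)) * (1 / real n)) (concat nss))"
    by (simp only: prod_list_map_mult)
  also have "\<dots> = prod_list (map (\<lambda>n. real n powr (- 1 - 1 / real T)) (concat nss))"
  proof (rule arg_cong[of _ _ prod_list], rule map_cong[OF refl])
    fix n assume "n \<in> set (concat nss)"
    then have "n \<ge> 1" using all_pos by auto
    then show "real n powr (- (1 / real T)) * (1 / real n) = real n powr (- 1 - 1 / real T)"
      by (simp add: powr_diff powr_minus_divide)
  qed
  finally show ?thesis
    unfolding T_def .
qed

text \<open>The bound \<open>cyc_weight_le_powr\<close> depends only on the flattened list and gives
  every entry an exponent below \<open>- 1\<close>, so it is a product of convergent series. Without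
  summability \<open>infsum\<close> would be 0 by default, and no rearrangement would be
  justified.\<close>

lemma zeta_cyc_has_sum:
  assumes "cyc_admissible kss"
  shows "(cyc_weight kss has_sum zeta_cyc kss) (cyc_domain kss)"
proof -
  define T where "T = sum_list (map length kss)"
  define g where "g = (\<lambda>n::nat. real n powr (- 1 - 1 / real T))"
  obtain ks where ks: "ks \<in> set kss" "ks \<noteq> []"
    using assms by (auto simp: cyc_admissible_def)
  then have "length ks \<le> T"
    unfolding T_def by (intro member_le_sum_list) auto
  then have "T > 0" using ks(2) by (cases ks) auto
  then have "summable g" unfolding g_def by (subst summable_real_powr_iff) simp
  then have "g summable_on UNIV"
    by (subst summable_on_UNIV_nonneg_real_iff) (simp_all add: g_def)
  then have lists: "(\<lambda>ns. prod_list (map g ns)) summable_on {ns. length ns = T}"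
    by (rule summable_on_lists_prod) (simp add: g_def)
  have sub: "concat ` cyc_domain kss \<subseteq> {ns. length ns = T}"
    by (auto simp: cyc_domain_iff T_def length_concat)
  have "inj_on concat (cyc_domain kss)"
    using inj_on_concat_lengths by (rule inj_on_subset) (auto simp: cyc_domain_iff)
  then have "((\<lambda>ns. prod_list (map g ns)) \<circ> concat) summable_on cyc_domain kss"
    using summable_on_subset_banach[OF lists sub] summable_on_reindex by blast
  then have "cyc_weight kss summable_on cyc_domain kss"
    by (rule summable_on_comparison_test)
      (use cyc_weight_le_powr[OF assms] in \<open>simp_all add: g_def T_def cyc_weight_nonneg\<close>)
  then show ?thesis by (simp add: zeta_cyc_eq_infsum)
qed

section \<open>The identity for words\<close>

definition insert_nth :: "nat \<Rightarrow> 'a \<Rightarrow> 'a list \<Rightarrow> 'a list" where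
  "insert_nth j x xs = take j xs @ x # drop j xs"

definition delete_nth :: "nat \<Rightarrow> 'a list \<Rightarrow> 'a list" where
  "delete_nth j xs = take j xs @ drop (Suc j) xs"

lemma length_insert_nth [simp]: "length (insert_nth j x xs) = Suc (length xs)"
  by (simp add: insert_nth_def)

lemma length_delete_nth [simp]: "j < length xs \<Longrightarrow> length (delete_nth j xs) = length xs - 1"
  by (simp add: delete_nth_def)

lemma delete_insert_nth [simp]: "j \<le> length xs \<Longrightarrow> delete_nth j (insert_nth j x xs) = xs"
  by (simp add: delete_nth_def insert_nth_def)

lemma insert_delete_nth [simp]: "j < length xs \<Longrightarrow> insert_nth j (xs ! j) (delete_nth j xs) = xs"
  by (simp add: delete_nth_def insert_nth_def id_take_nth_drop[symmetric])

lemma nth_insert_nth [simp]: "j \<le> length xs \<Longrightarrow> insert_nth j x xs ! j = x"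
  by (simp add: insert_nth_def nth_append)

lemma map_insert_nth: "map f (insert_nth j x xs) = insert_nth j (f x) (map f xs)"
  by (simp add: insert_nth_def take_map drop_map)

text \<open>The position is strictly inside the list, so by transitivity the two neighbours alone
  decide; the left one also makes \<open>n\<close> positive.\<close>

lemma pos_sorted_insert_nth:
  assumes "Suc j < length ns"
  shows "pos_sorted (insert_nth (Suc j) n ns) \<longleftrightarrow> pos_sorted ns \<and> ns ! j < n \<and> n < ns ! Suc j"
proof -
  let ?a = "ns ! j" and ?b = "ns ! Suc j"
  define xs ys where "xs = take j ns" and "ys = drop (Suc (Suc j)) ns"
  have ns: "ns = (xs @ [?a]) @ ?b # ys"
    using assms unfolding xs_def ys_def
    by (metis Suc_lessD id_take_nth_drop take_Suc_conv_app_nth)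
  have "length xs = j" using assms by (simp add: xs_def)
  then have ins: "insert_nth (Suc j) n ns = (xs @ [?a]) @ n # ?b # ys"
    using ns unfolding insert_nth_def by (metis append_eq_conv_conj length_append_singleton)
  show ?thesis
    \<comment> \<open>Only the \<open>ns\<close> of \<open>pos_sorted ns\<close> is to be split; the
      two earlier occurrences are inside \<open>?a\<close> and \<open>?b\<close>.\<close>
    unfolding ins by (subst (3) ns) (auto simp: pos_sorted_def sorted_wrt_append)
qed

lemma hd_last_insert_nth:
  assumes "Suc j < length ns"
  shows "hd (insert_nth (Suc j) n ns) = hd ns" "last (insert_nth (Suc j) n ns) = last ns"
  using assms by (auto simp: insert_nth_def hd_append)

lemma block_weight_insert_nth:
  assumes "length ns = length ks" "j \<le> length ks"
  shows "block_weight (insert_nth j k ks) (insert_nth j n ns) = block_weight ks ns / real n ^ k"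
proof -
  have "block_weight ks ns = block_weight (take j ks @ drop j ks) (take j ns @ drop j ns)" by simp
  also have "\<dots> = block_weight (take j ks) (take j ns) * block_weight (drop j ks) (drop j ns)"
    using assms by (intro block_weight_append) simp
  finally show ?thesis
    using assms by (simp add: insert_nth_def block_weight_append block_weight_Cons)
qed

lemma block_weight_contract:
  assumes "length ns = length ks" "j < length ks"
  shows "block_weight (ks[j := ks ! j + k]) ns = block_weight ks ns / real (ns ! j) ^ k"
  using assms
proof (induction ns ks arbitrary: j rule: list_induct2)
  case (Cons n ns l ks)
  then show ?case by (cases j) (auto simp: block_weight_Cons power_add)
qed simp

lemma cyc_weight_insert_nth:
  assumes "length nss = length kss" "j \<le> length kss"
  shows "cyc_weight (insert_nth j [k] kss) (insert_nth j [n] nss) = cyc_weight kss nss / real n ^ k"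
proof -
  have "cyc_weight kss nss = cyc_weight (take j kss @ drop j kss) (take j nss @ drop j nss)" by simp
  also have "\<dots> = cyc_weight (take j kss) (take j nss) * cyc_weight (drop j kss) (drop j nss)"
    using assms by (intro cyc_weight_append) simp
  finally show ?thesis
    using assms by (simp add: insert_nth_def cyc_weight_append cyc_weight_Cons block_weight_def)
qed

lemma cyc_weight_update_factor:
  assumes "i < length kss" "length nss = length kss" "block_weight (kss ! i) (nss ! i) \<noteq> 0"
    "block_weight ks ns = block_weight (kss ! i) (nss ! i) / c"
  shows "cyc_weight (kss[i := ks]) (nss[i := ns]) = cyc_weight kss nss / c"
proof -
  have "cyc_weight (kss[i := ks]) (nss[i := ns]) * block_weight (kss ! i) (nss ! i) =
      (cyc_weight kss nss / c) * block_weight (kss ! i) (nss ! i)"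
    using cyc_weight_update[OF assms(1,2), of ks ns] assms(4) by simp
  then show ?thesis using assms(3) mult_right_cancel by blast
qed

lemma block_weight_pos:
  "pos_sorted ns \<Longrightarrow> length ns = length ks \<Longrightarrow> block_weight ks ns > 0"
proof (induction ns arbitrary: ks)
  case (Cons n ns)
  then obtain k ks' where "ks = k # ks'" by (cases ks) auto
  with Cons show ?case by (auto simp: block_weight_Cons pos_sorted_def)
qed (simp add: block_weight_def)

lemma nth_list_update_if: "i < length xs \<Longrightarrow> xs[i := x] ! t = (if t = i then x else xs ! t)"
  by (cases "t = i") auto

text \<open>The inequalities between blocks see only the ends of a block, so its interior may change
  freely.\<close>

lemma cyc_domain_update:
  assumes "nss \<in> cyc_domain kss" "i < length kss" "length ns = length ks" "pos_sorted ns"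
    "hd ns = hd (nss ! i)" "last ns = last (nss ! i)"
  shows "nss[i := ns] \<in> cyc_domain (kss[i := ks])"
proof -
  note len = cyc_domain_lengths[OF assms(1)]
  have ends: "hd (nss[i := ns] ! t) = hd (nss ! t)" "last (nss[i := ns] ! t) = last (nss ! t)" for t
    using assms(2,5,6) len(1) by (simp_all add: nth_list_update_if)
  have "map length (nss[i := ns]) = map length (kss[i := ks])"
    using assms(1,3) by (simp add: cyc_domain_iff map_update)
  moreover have "pos_sorted (nss[i := ns] ! t)" if "t < length kss" for t
    using assms(1,2,4) that len(1) by (simp add: cyc_domain_iff nth_list_update_if)
  ultimately show ?thesis
    using assms(1) unfolding cyc_domain_iff ends length_list_update by blast
qed

text \<open>Repeating the head at the end opens the cycle into a chain. A chain condition splits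
  along \<open>@\<close>, which an index modulo the length does not.\<close>

lemma all_cyclic_iff_successively:
  assumes "xs \<noteq> []"
  shows "(\<forall>i<length xs. P (xs ! i) (xs ! (Suc i mod length xs))) \<longleftrightarrow> successively P (xs @ [hd xs])"
proof -
  have "(xs @ [hd xs]) ! Suc i = xs ! (Suc i mod length xs)" if "i < length xs" for i
    using that assms by (cases "Suc i = length xs") (auto simp: nth_append hd_conv_nth)
  then show ?thesis
    by (auto simp: successively_conv_nth nth_append)
qed

lemma cyc_domain_iff_successively:
  assumes "kss \<noteq> []"
  shows "nss \<in> cyc_domain kss \<longleftrightarrow> map length nss = map length kss \<and> (\<forall>ns\<in>set nss. pos_sorted ns)
     \<and> successively (\<lambda>a b. hd b \<le> last a) (nss @ [hd nss])"
proof (cases "map length nss = map length kss")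
  case True
  then have "length nss = length kss" by (metis length_map)
  moreover from this have "nss \<noteq> []" using assms by auto
  ultimately show ?thesis
    using all_cyclic_iff_successively[of nss "\<lambda>a b. hd b \<le> last a"]
    by (auto simp: cyc_domain_iff all_set_conv_all_nth)
qed (simp add: cyc_domain_iff)

text \<open>The new block \<open>[n]\<close> replaces one link of the cycle by two, one on each side
  of \<open>n\<close>, and these imply the old link by transitivity. For the last block the
  insertion is at the end of the list, and the next block is the first one.\<close>

lemma cyc_domain_insert_nth:
  assumes "i < length kss" "length nss = length kss"
  shows "insert_nth (Suc i) [n] nss \<in> cyc_domain (insert_nth (Suc i) [k] kss) \<longleftrightarrow>
    nss \<in> cyc_domain kss \<and> 1 \<le> n \<and> hd (nss ! (Suc i mod length kss)) \<le> n \<and> n \<le> last (nss ! i)"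
proof -
  define as bs where "as = take (Suc i) nss" and "bs = drop (Suc i) nss"
  have nss: "nss = as @ bs" by (simp add: as_def bs_def)
  have ne: "kss \<noteq> []" "nss \<noteq> []" "as \<noteq> []" using assms by (auto simp: as_def)
  have "last as = nss ! i" using assms by (simp add: as_def take_Suc_conv_app_nth)
  have hd: "hd nss = hd as" "hd (as @ xs) = hd as" for xs using ne nss by auto
  have "hd (bs @ [hd as]) = nss ! (Suc i mod length kss)"
  \<comment> \<open>If nothing follows the \<open>i\<close>-th block, the chain continues with its
    repeated head.\<close>
  proof (cases "Suc i = length kss")
    case True
    then show ?thesis using assms ne hd by (simp add: bs_def hd_conv_nth[OF ne(2), symmetric])
  next
    case False
    then have "bs \<noteq> []" "Suc i < length nss" using assms by (auto simp: bs_def)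
    then show ?thesis using assms by (simp add: bs_def hd_drop_conv_nth)
  qed
  have ins: "insert_nth (Suc i) [n] nss = as @ [n] # bs" by (simp add: insert_nth_def as_def bs_def)
  have "map length (insert_nth (Suc i) [n] nss) = map length (insert_nth (Suc i) [k] kss) \<longleftrightarrow>
      map length nss = map length kss"
    unfolding map_insert_nth using assms
    by (metis delete_insert_nth length_map length_Cons less_eq_Suc_le list.size(3))
  moreover have "successively (\<lambda>a b. hd b \<le> last a) ((as @ [n] # bs) @ [hd (as @ [n] # bs)]) \<longleftrightarrow>
      successively (\<lambda>a b. hd b \<le> last a) (nss @ [hd nss]) \<and>
      hd (nss ! (Suc i mod length kss)) \<le> n \<and> n \<le> last (nss ! i)"
    unfolding hd nss append_assoc append_Cons
    using ne(3) \<open>last as = nss ! i\<close> \<open>hd (bs @ [hd as]) = nss ! (Suc i mod length kss)\<close>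
    by (auto simp: successively_append_iff[of _ as] successively_Cons[of _ "[n]"] simp flip: nss)
  moreover have "(\<forall>ns\<in>set (as @ [n] # bs). pos_sorted ns) \<longleftrightarrow> (\<forall>ns\<in>set nss. pos_sorted ns) \<and> 1 \<le> n"
    unfolding nss by (auto simp: pos_sorted_def)
  moreover have "insert_nth (Suc i) [k] kss \<noteq> []" by (simp add: insert_nth_def)
  ultimately show ?thesis
    using ne(1) by (auto simp: cyc_domain_iff_successively ins)
qed

section \<open>Admissibility of the indices that occur\<close>

lemma cyc_admissible_update:
  assumes "cyc_admissible kss" "i < length kss" "ks \<noteq> []" "\<forall>k\<in>set ks. k \<ge> 1" "last ks \<ge> 2"
  shows "cyc_admissible (kss[i := ks])"
proof -
  have "ks \<noteq> [1]" using assms(5) by auto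
  \<comment> \<open>The replaced block may have been the only one other than \<open>[1]\<close>; the
    new block takes over as witness.\<close>
  then have "\<exists>ks\<in>set (kss[i := ks]). ks \<noteq> [1]"
    using set_update_memI[OF assms(2)] by blast
  then show ?thesis
    using assms set_update_subset_insert[of kss i ks] unfolding cyc_admissible_def by blast
qed

lemma cyc_admissible_blocks:
  assumes "cyc_admissible kss" "i < length kss"
  shows "kss ! i \<noteq> []" "\<forall>k\<in>set (kss ! i). k \<ge> 1" "kss ! i = [1] \<or> last (kss ! i) \<ge> 2"
  using assms by (auto simp: cyc_admissible_def)

lemma cyc_admissible_contract:
  assumes adm: "cyc_admissible kss" and i: "i < length kss" and j: "j < length (kss ! i)"
    and k: "k \<ge> 1"
  shows "cyc_admissible (kss[i := (kss ! i)[j := kss ! i ! j + k]])"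
proof (rule cyc_admissible_update[OF adm i])
  note blocks = cyc_admissible_blocks[OF adm i]
  show "(kss ! i)[j := kss ! i ! j + k] \<noteq> []" using blocks by simp
  show "\<forall>l\<in>set ((kss ! i)[j := kss ! i ! j + k]). l \<ge> 1"
    using blocks(2) k set_update_subset_insert[of "kss ! i" j] by fastforce
  show "last ((kss ! i)[j := kss ! i ! j + k]) \<ge> 2"
  proof (cases "kss ! i = [1]")
    case True
    \<comment> \<open>The block \<open>[1]\<close> becomes \<open>[1 + k]\<close>, whose entry is at
      least 2.\<close>
    then show ?thesis using j k by simp
  next
    case False
    then show ?thesis using blocks j by (auto simp: last_conv_nth nth_list_update_if)
  qed
qed

lemma cyc_admissible_insert:
  assumes adm: "cyc_admissible kss" and i: "i < length kss" and j: "Suc j < length (kss ! i)"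
    and k: "k \<ge> 1"
  shows "cyc_admissible (kss[i := insert_nth (Suc j) k (kss ! i)])"
proof (rule cyc_admissible_update[OF adm i])
  note blocks = cyc_admissible_blocks[OF adm i]
  show "insert_nth (Suc j) k (kss ! i) \<noteq> []" by (simp add: insert_nth_def)
  show "\<forall>l\<in>set (insert_nth (Suc j) k (kss ! i)). l \<ge> 1"
    using blocks(2) k by (auto simp: insert_nth_def dest: in_set_takeD in_set_dropD)
  show "last (insert_nth (Suc j) k (kss ! i)) \<ge> 2"
    using blocks(3) j by (auto simp: hd_last_insert_nth)
qed

lemma cyc_admissible_insert_block:
  assumes "cyc_admissible kss" "k \<ge> 1"
  shows "cyc_admissible (insert_nth i [k] kss)"
proof -
  have "set (insert_nth i [k] kss) = insert [k] (set (take i kss @ drop i kss))"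
    unfolding insert_nth_def set_append by simp
  then have "set (insert_nth i [k] kss) = insert [k] (set kss)" by simp
  then show ?thesis using assms by (auto simp: cyc_admissible_def)
qed

section \<open>The zeta values of both sides as sums over pairs of a domain point and a
  number\<close>

lemma cyc_domain_cong: "map length kss = map length kss' \<Longrightarrow> cyc_domain kss = cyc_domain kss'"
  by (simp add: cyc_domain_def)

text \<open>The number \<open>n\<close> is redundant here, but carrying it turns this value, like
  the next two, into a sum of one and the same function over a set of pairs. The contracted exponent
  contributes the extra factor \<open>1 / n ^ k\<close>.\<close>

lemma zeta_cyc_contract_has_sum:
  assumes adm: "cyc_admissible kss" and i: "i < length kss" and j: "j < length (kss ! i)"
    and k: "k \<ge> 1"
  shows "((\<lambda>(nss, n). cyc_weight kss nss / real n ^ k)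
      has_sum zeta_cyc (kss[i := (kss ! i)[j := kss ! i ! j + k]]))
    {(nss, n). nss \<in> cyc_domain kss \<and> n = nss ! i ! j}"
proof -
  let ?ks = "(kss ! i)[j := kss ! i ! j + k]"
  have "map length (kss[i := ?ks]) = map length kss"
    using i by (simp add: map_update list_update_same_conv)
  then have dom: "cyc_domain (kss[i := ?ks]) = cyc_domain kss" by (rule cyc_domain_cong)
  have "cyc_weight (kss[i := ?ks]) nss = cyc_weight kss nss / real (nss ! i ! j) ^ k"
    if "nss \<in> cyc_domain kss" for nss
  proof -
    note len = cyc_domain_lengths[OF that]
    have "pos_sorted (nss ! i)" using that i by (simp add: cyc_domain_iff)
    then have "block_weight (kss ! i) (nss ! i) \<noteq> 0"
      using block_weight_pos len(2)[OF i] by fastforce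
    then have "cyc_weight (kss[i := ?ks]) (nss[i := nss ! i]) = cyc_weight kss nss / real (nss ! i ! j) ^ k"
      using i j len by (intro cyc_weight_update_factor block_weight_contract) auto
    then show ?thesis by simp
  qed
  then have "(cyc_weight (kss[i := ?ks]) has_sum zeta_cyc (kss[i := ?ks])) (cyc_domain kss) \<longleftrightarrow> ?thesis"
    by (intro has_sum_reindex_bij_witness[where j = "\<lambda>nss. (nss, nss ! i ! j)" and i = fst]) auto
  then show ?thesis
    using zeta_cyc_has_sum[OF cyc_admissible_contract[OF assms]] dom by simp
qed

text \<open>Removing the inserted entry is a bijection onto the pairs in which \<open>n\<close> lies
  strictly between the two neighbouring entries.\<close>

lemma zeta_cyc_insert_has_sum:
  assumes adm: "cyc_admissible kss" and i: "i < length kss" and j: "Suc j < length (kss ! i)"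
    and k: "k \<ge> 1"
  shows "((\<lambda>(nss, n). cyc_weight kss nss / real n ^ k)
      has_sum zeta_cyc (kss[i := insert_nth (Suc j) k (kss ! i)]))
    {(nss, n). nss \<in> cyc_domain kss \<and> nss ! i ! j < n \<and> n < nss ! i ! Suc j}"
    (is "(?F has_sum ?z) ?E")
proof -
  let ?ks = "insert_nth (Suc j) k (kss ! i)"
  let ?ins = "\<lambda>(nss, n). nss[i := insert_nth (Suc j) n (nss ! i)]"
  let ?del = "\<lambda>mss. (mss[i := delete_nth (Suc j) (mss ! i)], mss ! i ! Suc j)"
  have "(?F has_sum ?z) ?E \<longleftrightarrow> (cyc_weight (kss[i := ?ks]) has_sum ?z) (cyc_domain (kss[i := ?ks]))"
  proof (rule has_sum_reindex_bij_witness[where j = ?ins and i = ?del])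
    fix a assume "a \<in> ?E"
    then obtain nss n where a: "a = (nss, n)" and nss: "nss \<in> cyc_domain kss"
      and n: "nss ! i ! j < n" "n < nss ! i ! Suc j" by auto
    note len = cyc_domain_lengths[OF nss]
    have sorted: "pos_sorted (nss ! i)" using nss i by (simp add: cyc_domain_iff)
    have j': "Suc j < length (nss ! i)" using j len(2)[OF i] by simp
    show "?del (?ins a) = a" using a i len(1) j' by simp
    show "?ins a \<in> cyc_domain (kss[i := ?ks])"
      using a n sorted j' len(2)[OF i]
      by (auto intro!: cyc_domain_update[OF nss i] simp: pos_sorted_insert_nth hd_last_insert_nth)
    have "block_weight (kss ! i) (nss ! i) \<noteq> 0"
      using block_weight_pos[OF sorted] len(2)[OF i] by fastforce
    then show "cyc_weight (kss[i := ?ks]) (?ins a) = ?F a"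
      using a i j len by (auto intro!: cyc_weight_update_factor block_weight_insert_nth)
  next
    fix mss assume mss: "mss \<in> cyc_domain (kss[i := ?ks])"
    note len = cyc_domain_lengths[OF mss]
    have i': "i < length (kss[i := ?ks])" using i by simp
    have li: "length (mss ! i) = Suc (length (kss ! i))"
      using len(2)[OF i'] i by simp
    then have j': "Suc j < length (mss ! i)" and j'': "Suc j < length (delete_nth (Suc j) (mss ! i))"
      using j by auto
    have ins: "insert_nth (Suc j) (mss ! i ! Suc j) (delete_nth (Suc j) (mss ! i)) = mss ! i"
      using j' by simp
    have sorted: "pos_sorted (mss ! i)" using mss i' by (simp add: cyc_domain_iff)
    show "?ins (?del mss) = mss" using ins i' len(1) by simp
    \<comment> \<open>The double update is \<open>kss\<close>; it is kept in this form to match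
      \<open>cyc_domain_update\<close>.\<close>
    have "mss[i := delete_nth (Suc j) (mss ! i)] \<in> cyc_domain ((kss[i := ?ks])[i := kss ! i])"
    proof (rule cyc_domain_update[OF mss i'])
      show "length (delete_nth (Suc j) (mss ! i)) = length (kss ! i)" using li j' by simp
      show "pos_sorted (delete_nth (Suc j) (mss ! i))"
        using sorted pos_sorted_insert_nth[OF j''] ins by metis
    qed (metis ins j'' hd_last_insert_nth)+
    moreover have "(delete_nth (Suc j) (mss ! i)) ! j < mss ! i ! Suc j"
      "mss ! i ! Suc j < (delete_nth (Suc j) (mss ! i)) ! Suc j"
      using sorted pos_sorted_insert_nth[OF j''] ins by metis+
    ultimately show "?del mss \<in> ?E" using i i' len(1) by simp
  qed simp
  then show ?thesis using zeta_cyc_has_sum[OF cyc_admissible_insert[OF assms]] by simp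
qed

text \<open>The bijection removes the inserted block, whose only entry becomes \<open>n\<close>; the
  inequalities on \<open>n\<close> are the two links from
  \<open>cyc_domain_insert_nth\<close>.\<close>

lemma zeta_cyc_insert_block_has_sum:
  assumes adm: "cyc_admissible kss" and i: "i < length kss" and k: "k \<ge> 1"
  shows "((\<lambda>(nss, n). cyc_weight kss nss / real n ^ k)
      has_sum zeta_cyc (insert_nth (Suc i) [k] kss))
    {(nss, n). nss \<in> cyc_domain kss \<and> 1 \<le> n \<and> hd (nss ! (Suc i mod length kss)) \<le> n \<and> n \<le> last (nss ! i)}"
    (is "(?F has_sum ?z) ?E")
proof -
  let ?kss = "insert_nth (Suc i) [k] kss"
  let ?ins = "\<lambda>(nss, n). insert_nth (Suc i) [n] nss"
  let ?del = "\<lambda>mss. (delete_nth (Suc i) mss, hd (mss ! Suc i))"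
  have "(?F has_sum ?z) ?E \<longleftrightarrow> (cyc_weight ?kss has_sum ?z) (cyc_domain ?kss)"
  proof (rule has_sum_reindex_bij_witness[where j = ?ins and i = ?del])
    fix a assume "a \<in> ?E"
    then obtain nss n where a: "a = (nss, n)" and nss: "nss \<in> cyc_domain kss"
      and n: "1 \<le> n" "hd (nss ! (Suc i mod length kss)) \<le> n" "n \<le> last (nss ! i)" by auto
    note len = cyc_domain_lengths[OF nss]
    show "?del (?ins a) = a" using a i len(1) by simp
    show "?ins a \<in> cyc_domain ?kss"
      using a n nss i len(1) by (simp add: cyc_domain_insert_nth)
    show "cyc_weight ?kss (?ins a) = ?F a"
      using a i len(1) by (simp add: cyc_weight_insert_nth)
  next
    fix mss assume mss: "mss \<in> cyc_domain ?kss"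
    note len = cyc_domain_lengths[OF mss]
    have i': "Suc i < length mss" using len(1) i by simp
    have "length (mss ! Suc i) = 1" using len(2)[of "Suc i"] i by simp
    then have m: "[hd (mss ! Suc i)] = mss ! Suc i" by (auto simp: length_Suc_conv)
    show inv: "?ins (?del mss) = mss" using i' m by simp
    have "length (delete_nth (Suc i) mss) = length kss" using i' len(1) by simp
    from cyc_domain_insert_nth[OF i this, of "hd (mss ! Suc i)" k] mss inv
    show "?del mss \<in> ?E" by simp
  qed simp
  then show ?thesis using zeta_cyc_has_sum[OF cyc_admissible_insert_block[OF adm k]] by simp
qed

section \<open>Counting the pairs and summing around the cycle\<close>

text \<open>The entries and the open gaps between them tile the interval from \<open>hd ns\<close>
  to \<open>last ns\<close>. Its indicator is written as a difference so that the parts can be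
  summed separately over the cycle.\<close>

lemma count_between_ends:
  fixes n :: nat
  assumes "sorted_wrt (<) ns" "ns \<noteq> []"
  shows "(\<Sum>j<length ns. of_bool (n = ns ! j)) +
      (\<Sum>j<length ns - 1. of_bool (ns ! j < n \<and> n < ns ! Suc j)) =
    (of_bool (n \<le> last ns) - of_bool (n < hd ns) :: real)"
  using assms
proof (induction ns rule: induct_list012)
  case (3 a b ns)
  have "a < b" and "b \<le> last (b # ns)"
    using "3.prems" by (auto simp: less_imp_le)
  have e1: "(\<Sum>j<length (a # b # ns). of_bool (n = (a # b # ns) ! j)) =
      (of_bool (n = a) + (\<Sum>j<length (b # ns). of_bool (n = (b # ns) ! j)) :: real)"
    by (simp add: sum.lessThan_Suc_shift del: sum.lessThan_Suc)
  have e2: "(\<Sum>j<length (a # b # ns) - 1. of_bool ((a # b # ns) ! j < n \<and> n < (a # b # ns) ! Suc j)) =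
      (of_bool (a < n \<and> n < b) +
        (\<Sum>j<length (b # ns) - 1. of_bool ((b # ns) ! j < n \<and> n < (b # ns) ! Suc j)) :: real)"
    by (simp add: sum.lessThan_Suc_shift del: sum.lessThan_Suc)
  have e3: "(\<Sum>j<length (b # ns). of_bool (n = (b # ns) ! j)) +
      (\<Sum>j<length (b # ns) - 1. of_bool ((b # ns) ! j < n \<and> n < (b # ns) ! Suc j)) =
      (of_bool (n \<le> last (b # ns)) - of_bool (n < b) :: real)"
    using "3.IH"(2) "3.prems" by simp
  \<comment> \<open>The interval from \<open>a\<close> to \<open>l\<close> consists of
    \<open>a\<close>, the gap up to \<open>b\<close>, and the interval from \<open>b\<close> to
    \<open>l\<close>.\<close>
  have key: "of_bool (n = a) + of_bool (a < n \<and> n < b) + (of_bool (n \<le> l) - of_bool (n < b)) =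
      (of_bool (n \<le> l) - of_bool (n < a) :: real)" if "b \<le> l" for l
    using \<open>a < b\<close> that by auto
  have "last (a # b # ns) = last (b # ns)" "hd (a # b # ns) = a" by auto
  then show ?case
    unfolding e1 e2 using e3 key[OF \<open>b \<le> last (b # ns)\<close>] by simp
qed auto

lemma sum_cyclic_shift:
  fixes f :: "nat \<Rightarrow> 'a::comm_monoid_add"
  shows "(\<Sum>i<s. f (Suc i mod s)) = (\<Sum>i<s. f i)"
proof (cases s)
  case (Suc m)
  have "(\<Sum>i<Suc m. f (Suc i mod Suc m)) = (\<Sum>i<m. f (Suc i mod Suc m)) + f 0" by simp
  also have "(\<Sum>i<m. f (Suc i mod Suc m)) = (\<Sum>i<m. f (Suc i))" by (rule sum.cong) auto
  also have "\<dots> + f 0 = (\<Sum>i<Suc m. f i)" by (simp add: sum.lessThan_Suc_shift add.commute del: sum.lessThan_Suc)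
  finally show ?thesis using Suc by simp
qed simp

lemma has_sum_sum:
  fixes f :: "'i \<Rightarrow> 'a \<Rightarrow> 'b::topological_comm_monoid_add"
  assumes "\<And>i. i \<in> I \<Longrightarrow> (f i has_sum s i) A"
  shows "((\<lambda>x. \<Sum>i\<in>I. f i x) has_sum (\<Sum>i\<in>I. s i)) A"
  using assms by (induction I rule: infinite_finite_induct) (auto intro: has_sum_add)

text \<open>Extension by zero brings series over different sets to one index set, where they can be
  added.\<close>

lemma has_sum_of_bool:
  fixes f :: "'a \<Rightarrow> real"
  assumes "(f has_sum z) E"
  shows "((\<lambda>x. f x * of_bool (x \<in> E)) has_sum z) UNIV"
  using assms by (subst has_sum_cong_neutral[where S = UNIV and T = E and g = f]) auto

lemma zeta_cyc_stuffle:
  assumes adm: "cyc_admissible kss" and k: "k \<ge> 1"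
  shows "(\<Sum>i<length kss.
      (\<Sum>j<length (kss ! i). zeta_cyc (kss[i := (kss ! i)[j := kss ! i ! j + k]])) +
      (\<Sum>j<length (kss ! i) - 1. zeta_cyc (kss[i := insert_nth (Suc j) k (kss ! i)]))) =
    (\<Sum>i<length kss. zeta_cyc (insert_nth (Suc i) [k] kss))" (is "?L = ?R")
proof -
  let ?s = "length kss"
  \<comment> \<open>\<open>F\<close> is the common summand; \<open>C\<close>, \<open>B\<close> and
    \<open>G\<close> are the sets of pairs for contractions, insertions into a block and insertions
    of a block. It remains to compare how often each pair is counted.\<close>
  define F where "F = (\<lambda>(nss, n). cyc_weight kss nss / real n ^ k)"
  define C where "C i j = {(nss, n). nss \<in> cyc_domain kss \<and> n = nss ! i ! j}" for i j
  define B where "B i j = {(nss, n). nss \<in> cyc_domain kss \<and> nss ! i ! j < n \<and> n < nss ! i ! Suc j}"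
    for i j
  define G where "G i = {(nss, n). nss \<in> cyc_domain kss \<and> 1 \<le> n \<and>
    hd (nss ! (Suc i mod ?s)) \<le> n \<and> n \<le> last (nss ! i)}" for i
  have L: "((\<lambda>x. \<Sum>i<?s. (\<Sum>j<length (kss ! i). F x * of_bool (x \<in> C i j)) +
      (\<Sum>j<length (kss ! i) - 1. F x * of_bool (x \<in> B i j))) has_sum ?L) UNIV"
    unfolding F_def C_def B_def
    by (intro has_sum_sum has_sum_add has_sum_of_bool zeta_cyc_contract_has_sum
        zeta_cyc_insert_has_sum adm k) auto
  have R: "((\<lambda>x. \<Sum>i<?s. F x * of_bool (x \<in> G i)) has_sum ?R) UNIV"
    unfolding F_def G_def
    by (intro has_sum_sum has_sum_of_bool zeta_cyc_insert_block_has_sum adm k) auto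
  have "(\<Sum>i<?s. (\<Sum>j<length (kss ! i). F x * of_bool (x \<in> C i j)) +
      (\<Sum>j<length (kss ! i) - 1. F x * of_bool (x \<in> B i j))) =
      (\<Sum>i<?s. F x * of_bool (x \<in> G i))" for x
  proof -
    obtain nss n where x: "x = (nss, n)" by (cases x)
    show ?thesis
    proof (cases "nss \<in> cyc_domain kss")
      case True
      note len = cyc_domain_lengths[OF True]
      let ?le = "\<lambda>i. of_bool (n \<le> last (nss ! i)) :: real"
      let ?less = "\<lambda>i. of_bool (n < hd (nss ! i)) :: real"
      have inner: "(\<Sum>j<length (kss ! i). F x * of_bool (x \<in> C i j)) +
          (\<Sum>j<length (kss ! i) - 1. F x * of_bool (x \<in> B i j)) = F x * (?le i - ?less i)"
        if i: "i < ?s" for i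
      proof -
        have "nss ! i \<noteq> []" "sorted_wrt (<) (nss ! i)"
          using cyc_admissible_blocks(1)[OF adm i] len(2)[OF i] True i
          by (auto simp: cyc_domain_iff pos_sorted_def)
        note count = count_between_ends[OF this(2,1), of n, symmetric]
        have mem: "x \<in> C i j \<longleftrightarrow> n = nss ! i ! j"
          "x \<in> B i j \<longleftrightarrow> nss ! i ! j < n \<and> n < nss ! i ! Suc j" for j
          using True by (simp_all add: x C_def B_def)
        show ?thesis
          unfolding count mem len(2)[OF i] by (simp only: distrib_left sum_distrib_left)
      qed
      have outer: "of_bool (x \<in> G i) = ?le i - ?less (Suc i mod ?s)" if i: "i < ?s" for i
      proof -
        let ?t = "Suc i mod ?s"
        have t: "?t < ?s" using i by (intro mod_less_divisor) auto
        \<comment> \<open>The head of the next block is positive, so the condition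
          \<open>1 \<le> n\<close> in \<open>G\<close> follows from the lower bound on
          \<open>n\<close>.\<close>
        have "hd (nss ! ?t) \<in> set (nss ! ?t)"
          using cyc_admissible_blocks(1)[OF adm t] len(2)[OF t] by (intro hd_in_set) auto
        then have "1 \<le> hd (nss ! ?t)" using True t by (auto simp: cyc_domain_iff pos_sorted_def)
        moreover have "hd (nss ! ?t) \<le> last (nss ! i)" using True i by (simp add: cyc_domain_iff)
        ultimately show ?thesis using True by (auto simp: x G_def)
      qed
      have "(\<Sum>i<?s. F x * (?le i - ?less i)) = F x * ((\<Sum>i<?s. ?le i) - (\<Sum>i<?s. ?less i))"
        by (simp only: sum_distrib_left[symmetric] sum_subtractf)
      \<comment> \<open>The cyclic shift exchanges the first entry of each block for that of the
        next.\<close>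
      also have "(\<Sum>i<?s. ?less i) = (\<Sum>i<?s. ?less (Suc i mod ?s))"
        by (rule sum_cyclic_shift[symmetric])
      also have "F x * ((\<Sum>i<?s. ?le i) - (\<Sum>i<?s. ?less (Suc i mod ?s))) =
          F x * (\<Sum>i<?s. ?le i - ?less (Suc i mod ?s))"
        by (simp only: sum_subtractf)
      also have "(\<Sum>i<?s. ?le i - ?less (Suc i mod ?s)) = (\<Sum>i<?s. of_bool (x \<in> G i))"
        using outer by (intro sum.cong) auto
      finally have "(\<Sum>i<?s. F x * (?le i - ?less i)) = (\<Sum>i<?s. F x * of_bool (x \<in> G i))"
        by (simp only: sum_distrib_left)
      moreover have "(\<Sum>i<?s. (\<Sum>j<length (kss ! i). F x * of_bool (x \<in> C i j)) +
          (\<Sum>j<length (kss ! i) - 1. F x * of_bool (x \<in> B i j))) = (\<Sum>i<?s. F x * (?le i - ?less i))"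
        using inner by (intro sum.cong) auto
      ultimately show ?thesis by simp
    qed (simp add: x C_def B_def G_def)
  qed
  then show ?thesis using has_sum_unique[OF L] R by simp
qed

section \<open>Multilinearity\<close>

definition lin :: "falg \<Rightarrow> (letter list \<Rightarrow> real) \<Rightarrow> real" where
  "lin u \<psi> = (\<Sum>w\<in>Poly_Mapping.keys u. of_rat (Poly_Mapping.lookup u w) * \<psi> w)"

text \<open>The linear functional with values \<open>\<phi>\<close> on the basis tensors, evaluated
  on a pure tensor one factor at a time. This form permits rewriting in a single factor.\<close>

fun tlin :: "falg list \<Rightarrow> (letter list list \<Rightarrow> real) \<Rightarrow> real" where
  "tlin [] \<phi> = \<phi> []"
| "tlin (u # us) \<phi> = lin u (\<lambda>w. tlin us (\<lambda>ws. \<phi> (w # ws)))"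

text \<open>Gives several elements a common index set, since the keys of a sum may shrink by
  cancellation.\<close>

lemma lin_superset:
  assumes "finite A" "Poly_Mapping.keys u \<subseteq> A"
  shows "lin u \<psi> = (\<Sum>w\<in>A. of_rat (Poly_Mapping.lookup u w) * \<psi> w)"
  unfolding lin_def using assms by (intro sum.mono_neutral_left) (auto simp: in_keys_iff)

lemma lin_add: "lin (u + v) \<psi> = lin u \<psi> + lin v \<psi>"
proof -
  let ?A = "Poly_Mapping.keys u \<union> Poly_Mapping.keys v"
  have "lin (u + v) \<psi> = (\<Sum>w\<in>?A. of_rat (Poly_Mapping.lookup (u + v) w) * \<psi> w)"
    using Poly_Mapping.keys_add[of u v] by (intro lin_superset) auto
  also have "\<dots> = (\<Sum>w\<in>?A. of_rat (Poly_Mapping.lookup u w) * \<psi> w) +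
      (\<Sum>w\<in>?A. of_rat (Poly_Mapping.lookup v w) * \<psi> w)"
    by (simp add: lookup_add of_rat_add distrib_right sum.distrib)
  finally show ?thesis using lin_superset[of ?A u \<psi>] lin_superset[of ?A v \<psi>] by simp
qed

lemma lin_zero [simp]: "lin 0 \<psi> = 0"
  by (simp add: lin_def)

lemma lin_sum: "lin (\<Sum>i\<in>I. u i) \<psi> = (\<Sum>i\<in>I. lin (u i) \<psi>)"
  by (induction I rule: infinite_finite_induct) (simp_all add: lin_add)

lemma lin_single: "lin (Poly_Mapping.single w c) \<psi> = of_rat c * \<psi> w"
  by (simp add: lin_def)

lemma lin_cong: "(\<And>w. w \<in> Poly_Mapping.keys u \<Longrightarrow> \<psi> w = \<psi>' w) \<Longrightarrow> lin u \<psi> = lin u \<psi>'"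
  by (simp add: lin_def)

lemma lin_sum_right: "lin u (\<lambda>w. \<Sum>i\<in>I. \<psi> i w) = (\<Sum>i\<in>I. lin u (\<psi> i))"
  unfolding lin_def sum_distrib_left by (rule sum.swap)

text \<open>Coefficients of a pure tensor multiply, and a product of nonzero rationals is nonzero,
  so no key is lost.\<close>

lemma keys_tensor_Cons:
  "Poly_Mapping.keys (tensor (u # us)) =
    (\<lambda>(w, ws). w # ws) ` (Poly_Mapping.keys u \<times> Poly_Mapping.keys (tensor us))"
  and lookup_tensor_Cons: "Poly_Mapping.lookup (tensor (u # us)) (w # ws) =
    Poly_Mapping.lookup u w * Poly_Mapping.lookup (tensor us) ws"
proof -
  show *: "Poly_Mapping.lookup (tensor (u # us)) (w # ws) =
    Poly_Mapping.lookup u w * Poly_Mapping.lookup (tensor us) ws" for w ws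
    by (simp add: tensor.rep_eq prod.lessThan_Suc_shift del: prod.lessThan_Suc)
  have "Poly_Mapping.lookup (tensor (u # us)) [] = 0"
    by (simp add: tensor.rep_eq)
  then have "vs \<in> Poly_Mapping.keys (tensor (u # us)) \<longleftrightarrow>
      vs \<in> (\<lambda>(w, ws). w # ws) ` (Poly_Mapping.keys u \<times> Poly_Mapping.keys (tensor us))" for vs
    by (cases vs) (auto simp: in_keys_iff *)
  then show "Poly_Mapping.keys (tensor (u # us)) =
    (\<lambda>(w, ws). w # ws) ` (Poly_Mapping.keys u \<times> Poly_Mapping.keys (tensor us))" by blast
qed

lemma sum_tensor_eq_tlin:
  "(\<Sum>ws\<in>Poly_Mapping.keys (tensor us). of_rat (Poly_Mapping.lookup (tensor us) ws) * \<phi> ws) = tlin us \<phi>"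
proof (induction us arbitrary: \<phi>)
  case Nil
  have "tensor [] = Poly_Mapping.single [] 1" using tensor_words[of "[]"] by simp
  then show ?case by simp
next
  case (Cons u us)
  have inj: "inj_on (\<lambda>(w, ws). w # ws) A" for A :: "('b \<times> 'b list) set"
    by (auto simp: inj_on_def)
  have "(\<Sum>ws\<in>Poly_Mapping.keys (tensor (u # us)).
        of_rat (Poly_Mapping.lookup (tensor (u # us)) ws) * \<phi> ws) =
      (\<Sum>(w, ws)\<in>Poly_Mapping.keys u \<times> Poly_Mapping.keys (tensor us).
        of_rat (Poly_Mapping.lookup u w) * (of_rat (Poly_Mapping.lookup (tensor us) ws) * \<phi> (w # ws)))"
    unfolding keys_tensor_Cons
    by (subst sum.reindex[OF inj])
      (simp add: case_prod_beta lookup_tensor_Cons of_rat_mult mult.assoc)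
  also have "\<dots> = tlin (u # us) \<phi>"
    by (simp add: sum.cartesian_product[symmetric] sum_distrib_left[symmetric] Cons.IH lin_def)
  finally show ?case .
qed

lemma Zcyc_tensor: "Zcyc (tensor us) = tlin us (\<lambda>ws. zeta_cyc (map index_of ws))"
  unfolding Zcyc_def by (rule sum_tensor_eq_tlin)

lemma tlin_append: "tlin (us @ vs) \<phi> = tlin us (\<lambda>ws. tlin vs (\<lambda>ws'. \<phi> (ws @ ws')))"
  by (induction us arbitrary: \<phi>) simp_all

text \<open>Restricting to words that occur in the factors matters: only for these are the indices
  known to be admissible.\<close>

lemma tlin_cong:
  assumes "\<And>ws. list_all2 (\<lambda>u w. w \<in> Poly_Mapping.keys u) us ws \<Longrightarrow> \<phi> ws = \<phi>' ws"
  shows "tlin us \<phi> = tlin us \<phi>'"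
  using assms
proof (induction us arbitrary: \<phi> \<phi>')
  case (Cons u us)
  have "tlin us (\<lambda>ws. \<phi> (w # ws)) = tlin us (\<lambda>ws. \<phi>' (w # ws))" if "w \<in> Poly_Mapping.keys u" for w
    using that by (intro Cons.IH Cons.prems) simp
  then show ?case by (simp cong: lin_cong)
qed simp

lemma tlin_sum: "tlin us (\<lambda>ws. \<Sum>i\<in>I. \<phi> i ws) = (\<Sum>i\<in>I. tlin us (\<phi> i))"
  by (induction us arbitrary: \<phi>) (simp_all add: lin_sum_right)

text \<open>The functionals \<open>lin v \<psi>\<close> are all that \<open>tlin\<close> uses of the
  factor \<open>v\<close>. If they amount to replacing each word \<open>w\<close> of
  \<open>us ! i\<close> by the words \<open>h w p\<close>, the same replacement acts at position
  \<open>i\<close> of the basis tensors.\<close>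

lemma tlin_replace:
  assumes i: "i < length us" and v: "\<And>\<psi>. lin v \<psi> = lin (us ! i) (\<lambda>w. \<Sum>p\<in>I w. \<psi> (h w p))"
  shows "tlin (take i us @ [v] @ drop (Suc i) us) \<phi> =
    tlin us (\<lambda>ws. \<Sum>p\<in>I (ws ! i). \<phi> (ws[i := h (ws ! i) p]))"
proof -
  let ?\<Phi> = "\<lambda>ws. \<Sum>p\<in>I (ws ! i). \<phi> (ws[i := h (ws ! i) p])"
  have "tlin (take i us @ [v] @ drop (Suc i) us) \<phi> =
      tlin (take i us) (\<lambda>as. lin (us ! i) (\<lambda>w. tlin (drop (Suc i) us)
        (\<lambda>bs. \<Sum>p\<in>I w. \<phi> (as @ h w p # bs))))"
    by (simp add: tlin_append v tlin_sum)
  also have "\<dots> = tlin (take i us) (\<lambda>as. lin (us ! i) (\<lambda>w. tlin (drop (Suc i) us)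
        (\<lambda>bs. ?\<Phi> (as @ w # bs))))"
  proof (rule tlin_cong)
    fix as assume "list_all2 (\<lambda>u w. w \<in> Poly_Mapping.keys u) (take i us) as"
    \<comment> \<open>The length of \<open>as\<close> identifies \<open>w\<close> as the entry at
      position \<open>i\<close> of \<open>as @ w # bs\<close>.\<close>
    then have "length as = i" using i by (auto dest: list_all2_lengthD)
    then show "lin (us ! i) (\<lambda>w. tlin (drop (Suc i) us) (\<lambda>bs. \<Sum>p\<in>I w. \<phi> (as @ h w p # bs))) =
        lin (us ! i) (\<lambda>w. tlin (drop (Suc i) us) (\<lambda>bs. ?\<Phi> (as @ w # bs)))"
      by (simp add: list_update_append nth_append)
  qed
  also have "\<dots> = tlin (take i us @ us ! i # drop (Suc i) us) ?\<Phi>"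
    by (simp add: tlin_append)
  finally show ?thesis using id_take_nth_drop[OF i] by simp
qed

lemma zz_eq_single: "zz k = Poly_Mapping.single (zword [k]) 1"
  using single_zword[of "[k]"] by simp

lemma tlin_insert_zz:
  assumes i: "i < length us"
  shows "tlin (take (Suc i) us @ [zz k] @ drop (Suc i) us) \<phi> =
    tlin us (\<lambda>ws. \<phi> (insert_nth (Suc i) (zword [k]) ws))"
proof -
  have "tlin (take (Suc i) us @ [zz k] @ drop (Suc i) us) \<phi> =
      tlin (take (Suc i) us) (\<lambda>as. tlin (drop (Suc i) us) (\<lambda>bs. \<phi> (as @ zword [k] # bs)))"
    by (simp add: tlin_append lin_single zz_eq_single)
  also have "\<dots> = tlin (take (Suc i) us) (\<lambda>as. tlin (drop (Suc i) us)
      (\<lambda>bs. \<phi> (insert_nth (Suc i) (zword [k]) (as @ bs))))"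
  proof (rule tlin_cong)
    fix as assume "list_all2 (\<lambda>u w. w \<in> Poly_Mapping.keys u) (take (Suc i) us) as"
    then have "length as = Suc i" using i by (auto dest: list_all2_lengthD)
    then show "tlin (drop (Suc i) us) (\<lambda>bs. \<phi> (as @ zword [k] # bs)) =
        tlin (drop (Suc i) us) (\<lambda>bs. \<phi> (insert_nth (Suc i) (zword [k]) (as @ bs)))"
      by (simp add: insert_nth_def)
  qed
  also have "\<dots> = tlin us (\<lambda>ws. \<phi> (insert_nth (Suc i) (zword [k]) ws))"
    using tlin_append[of "take (Suc i) us" "drop (Suc i) us"] by simp
  finally show ?thesis .
qed

section \<open>The words in elements of \<open>hC0\<close>\<close>

lemma zword_append: "zword (ks @ ls) = zword ks @ zword ls"
  by (simp add: zword_def)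

text \<open>Reading from left to right, a letter \<open>LX\<close> raises the last entry by one and
  a letter \<open>LY\<close> opens a new entry 1.\<close>

lemma LY_word_eq_zword: "\<exists>ls. ls \<noteq> [] \<and> (\<forall>l\<in>set ls. l \<ge> 1) \<and> LY # v = zword ls"
proof (induction v rule: rev_induct)
  case Nil
  show ?case by (intro exI[of _ "[1]"]) (simp add: zword_def)
next
  case (snoc a v)
  then obtain ls where ls: "ls \<noteq> []" "\<forall>l\<in>set ls. l \<ge> 1" "LY # v = zword ls" by blast
  show ?case
  proof (cases a)
    case LX
    obtain ms m where ms: "ls = ms @ [m]" using ls(1) by (cases ls rule: rev_cases) auto
    then have "m \<ge> 1" using ls(2) by simp
    then have "zword [m] @ [LX] = zword [Suc m]"
      by (cases m) (auto simp: zword_def replicate_append_same)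
    then have "LY # v @ [a] = zword (ms @ [Suc m])"
      using ls(3) LX by (simp add: ms zword_append flip: append_Cons)
    then show ?thesis using ls(2) ms by (intro exI[of _ "ms @ [Suc m]"]) auto
  next
    case LY
    then have "LY # v @ [a] = zword (ls @ [1])"
      using ls(3) by (simp add: zword_append zword_def)
    then show ?thesis using ls(2) by (intro exI[of _ "ls @ [1]"]) auto
  qed
qed

text \<open>Membership in \<open>hC\<close> rules out the empty word, so the constant in
  \<open>h0\<close> contributes nothing. The remaining words begin with \<open>LY\<close> and end
  with \<open>LX\<close>, whereas a last entry 1 would make the word end with
  \<open>LY\<close>.\<close>

lemma keys_hC0:
  assumes u: "u \<in> hC0" and w: "w \<in> Poly_Mapping.keys u"
  obtains ls where "ls \<noteq> []" "\<forall>l\<in>set ls. l \<ge> 1" "last ls \<ge> 2" "w = zword ls"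
proof -
  obtain c a where "u = scalar c + yy * a * xx" using u by (auto simp: hC0_def h0_def)
  then have "w \<in> Poly_Mapping.keys (scalar c) \<union> Poly_Mapping.keys (yy * a * xx)"
    using w Poly_Mapping.keys_add[of "scalar c" "yy * a * xx"] by auto
  moreover have "w \<noteq> []"
  proof -
    obtain a b where "u = a * xx + b * yy" using u by (auto simp: hC0_def hC_def)
    then have "w \<in> Poly_Mapping.keys (a * xx) \<union> Poly_Mapping.keys (b * yy)"
      using w Poly_Mapping.keys_add[of "a * xx" "b * yy"] by auto
    then show ?thesis
      using keys_mult[of a xx] keys_mult[of b yy] by (auto simp: xx_def yy_def plus_list_def)
  qed
  ultimately have "w \<in> Poly_Mapping.keys (yy * a * xx)"
    by (auto simp: zero_list_def split: if_splits)
  then obtain w1 w2 where w1: "w = w1 + w2" "w1 \<in> Poly_Mapping.keys (yy * a)" "w2 \<in> Poly_Mapping.keys xx"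
    using keys_mult[of "yy * a" xx] by blast
  then obtain v0 v where v0: "w1 = v0 + v" "v0 \<in> Poly_Mapping.keys yy"
    using keys_mult[of yy a] by blast
  have v: "w = LY # v @ [LX]"
    using w1(1,3) v0 by (simp add: xx_def yy_def plus_list_def)
  obtain ls where ls: "ls \<noteq> []" "\<forall>l\<in>set ls. l \<ge> 1" "w = zword ls"
    using LY_word_eq_zword[of "v @ [LX]"] v by auto
  have "last ls \<noteq> 1"
  proof
    assume "last ls = 1"
    then have "ls = butlast ls @ [1]" using ls(1) by (metis append_butlast_last_id)
    then have "w = zword (butlast ls) @ [LY]" using ls(3) zword_append[of "butlast ls" "[1]"]
      by (simp add: zword_def)
    then show False using v by simp
  qed
  moreover have "last ls \<ge> 1" using ls(1,2) by simp
  ultimately have "last ls \<ge> 2" by linarith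
  then show thesis using ls that by blast
qed

section \<open>The products with one letter on linear combinations of words\<close>

text \<open>\<open>Inl\<close> marks contractions and \<open>Inr\<close> insertions; the disjoint
  union gives the single sum that \<open>tlin_replace\<close> expects.\<close>

definition inner_terms :: "nat list \<Rightarrow> (nat + nat) set" where
  "inner_terms ls = {..<length ls} <+> {..<length ls - 1}"

definition inner_term :: "nat \<Rightarrow> nat list \<Rightarrow> nat + nat \<Rightarrow> nat list" where
  "inner_term k ls = case_sum (\<lambda>j. ls[j := ls ! j + k]) (\<lambda>j. insert_nth (Suc j) k ls)"

lemma sum_inner_terms:
  "(\<Sum>p\<in>inner_terms ls. f (inner_term k ls p)) =
    (\<Sum>j<length ls. f (ls[j := ls ! j + k])) + (\<Sum>j<length ls - 1. f (insert_nth (Suc j) k ls))"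
  by (simp add: inner_terms_def inner_term_def sum.Plus)

lemma inner_term_pos:
  assumes "\<forall>l\<in>set ls. l \<ge> 1" "k \<ge> 1"
  shows "\<forall>l\<in>set (inner_term k ls p). l \<ge> 1"
proof (cases p)
  case (Inl j)
  have "\<forall>l\<in>set (ls[j := ls ! j + k]). l \<ge> 1"
    using assms set_update_subset_insert[of ls j] by fastforce
  then show ?thesis by (simp add: inner_term_def Inl)
next
  case (Inr j)
  then show ?thesis
    using assms by (auto simp: inner_term_def insert_nth_def dest: in_set_takeD in_set_dropD)
qed

lemma stuffle_sum_inner_terms:
  assumes "ls \<noteq> []"
  shows "stuffle_sum inner_stuffles [k] ls =
    (\<Sum>p\<in>inner_terms ls. Poly_Mapping.single (zword (inner_term k ls p)) 1)"
proof -
  have "sum f {1..<length ls} = (\<Sum>j<length ls - 1. f (Suc j))" for f :: "nat \<Rightarrow> falg"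
    by (rule sum.reindex_bij_witness[where i = Suc and j = "\<lambda>j. j - 1"]) auto
  then show ?thesis
    using sum_inner_terms[where f = "\<lambda>v. Poly_Mapping.single (zword v) (1::rat)"]
    unfolding stuffle_sum_inner_stuffles[OF assms] by (simp add: insert_nth_def)
qed

lemma bilinear_ext_zz:
  assumes "k \<ge> 1"
  shows "bilinear_ext B (zz k) u =
    (\<Sum>w\<in>Poly_Mapping.keys u. scalar (Poly_Mapping.lookup u w) * B [k] (index_of w))"
proof -
  have "index_of (zword [k]) = [k]" using assms by (intro index_of_zword) simp
  then show ?thesis by (simp add: bilinear_ext_def zz_eq_single)
qed

lemma scalar_times_single: "scalar c * Poly_Mapping.single w d = Poly_Mapping.single w (c * d)"
  by (simp add: mult_single)

lemma lin_inner_harmonic: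
  assumes "k \<ge> 1" "\<And>w. w \<in> Poly_Mapping.keys u \<Longrightarrow> index_of w \<noteq> []"
  shows "lin (inner_harmonic (zz k) u) \<psi> =
    lin u (\<lambda>w. \<Sum>p\<in>inner_terms (index_of w). \<psi> (zword (inner_term k (index_of w) p)))"
  unfolding inner_harmonic_def bilinear_ext_zz[OF assms(1)] lin_sum
  unfolding lin_def[of u]
  by (rule sum.cong)
    (simp_all add: assms(2) stuffle_sum_inner_terms sum_distrib_left scalar_times_single lin_sum lin_single)

lemma sum_singles: "(\<Sum>w\<in>Poly_Mapping.keys u. Poly_Mapping.single w (Poly_Mapping.lookup u w)) = u"
  by (rule poly_mapping_eqI)
    (simp add: lookup_sum lookup_single when_def in_keys_iff sum.delta)

text \<open>All four products are expanded over the words of \<open>u\<close>, where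
  \<open>stuffle_sum_inner_eq\<close> applies. The concatenations rely on
  \<open>w = zword (index_of w)\<close>, as \<open>index_of\<close> is arbitrary on words outside
  \<open>h1\<close>.\<close>

lemma inner_harmonic_eq:
  assumes k: "k \<ge> 1"
    and u: "\<And>w. w \<in> Poly_Mapping.keys u \<Longrightarrow> index_of w \<noteq> [] \<and> w = zword (index_of w)"
  shows "inner_harmonic (zz k) u = harmonic (zz k) u - zz k * u - u * zz k"
proof -
  let ?c = "Poly_Mapping.lookup u"
  have left: "zz k * u = (\<Sum>w\<in>Poly_Mapping.keys u. Poly_Mapping.single (zword (k # index_of w)) (?c w))"
  proof -
    have "zz k * u = (\<Sum>w\<in>Poly_Mapping.keys u. zz k * Poly_Mapping.single w (?c w))"
      by (subst sum_singles[of u, symmetric]) (rule sum_distrib_left)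
    also have "\<dots> = (\<Sum>w\<in>Poly_Mapping.keys u. Poly_Mapping.single (zword (k # index_of w)) (?c w))"
    proof (rule sum.cong[OF refl])
      fix w assume "w \<in> Poly_Mapping.keys u"
      then have "zword [k] + w = zword (k # index_of w)"
        using u[of w] zword_append[of "[k]" "index_of w"] by (simp add: plus_list_def)
      then show "zz k * Poly_Mapping.single w (?c w) = Poly_Mapping.single (zword (k # index_of w)) (?c w)"
        by (simp add: zz_eq_single mult_single)
    qed
    finally show ?thesis .
  qed
  have right: "u * zz k = (\<Sum>w\<in>Poly_Mapping.keys u. Poly_Mapping.single (zword (index_of w @ [k])) (?c w))"
  proof -
    have "u * zz k = (\<Sum>w\<in>Poly_Mapping.keys u. Poly_Mapping.single w (?c w) * zz k)"
      by (subst sum_singles[of u, symmetric]) (rule sum_distrib_right)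
    also have "\<dots> = (\<Sum>w\<in>Poly_Mapping.keys u. Poly_Mapping.single (zword (index_of w @ [k])) (?c w))"
    proof (rule sum.cong[OF refl])
      fix w assume "w \<in> Poly_Mapping.keys u"
      then have "w + zword [k] = zword (index_of w @ [k])"
        using u[of w] by (simp add: plus_list_def zword_append)
      then show "Poly_Mapping.single w (?c w) * zz k = Poly_Mapping.single (zword (index_of w @ [k])) (?c w)"
        by (simp add: zz_eq_single mult_single)
    qed
    finally show ?thesis .
  qed
  have "inner_harmonic (zz k) u = (\<Sum>w\<in>Poly_Mapping.keys u.
      scalar (?c w) * stuffle_sum stuffles [k] (index_of w)
      - Poly_Mapping.single (zword (k # index_of w)) (?c w)
      - Poly_Mapping.single (zword (index_of w @ [k])) (?c w))"
    unfolding inner_harmonic_def bilinear_ext_zz[OF k]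
    by (rule sum.cong) (simp_all add: u stuffle_sum_inner_eq right_diff_distrib scalar_times_single)
  then show ?thesis
    unfolding left right harmonic_def bilinear_ext_zz[OF k] by (simp only: sum_subtractf)
qed

section \<open>The identity for arbitrary factors\<close>

theorem theorem1p3:
  fixes us :: "falg list" and k :: nat
  assumes "length us \<ge> 1"
    and "\<forall>u\<in>set us. u \<in> hC0 \<union> {yy}"
    and "\<exists>u\<in>set us. u \<noteq> yy"
    and "k \<ge> 1"
  shows "(\<Sum>i<length us. Zcyc (tensor (take i us @ [inner_harmonic (zz k) (us ! i)] @ drop (Suc i) us)))
       = (\<Sum>i<length us. Zcyc (tensor (take (Suc i) us @ [zz k] @ drop (Suc i) us)))
     \<and> (\<forall>i<length us. inner_harmonic (zz k) (us ! i) =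
          harmonic (zz k) (us ! i) - zz k * (us ! i) - (us ! i) * zz k)"
proof -
  let ?\<phi> = "\<lambda>ws. zeta_cyc (map index_of ws)"
  have yy: "yy = Poly_Mapping.single (zword [1]) 1" by (simp add: yy_def zword_def)
  \<comment> \<open>Admissibility must hold for every word of every factor, since expanding the
    tensors mixes arbitrary choices of words.\<close>
  have keys: "index_of w \<noteq> [] \<and> (\<forall>l\<in>set (index_of w). l \<ge> 1) \<and> w = zword (index_of w) \<and>
      (index_of w = [1] \<or> last (index_of w) \<ge> 2) \<and> (u \<noteq> yy \<longrightarrow> index_of w \<noteq> [1])"
    if u: "u \<in> set us" and w: "w \<in> Poly_Mapping.keys u" for u w
  proof (cases "u = yy")
    case True
    then have "w = zword [1]" using w by (simp add: yy)
    moreover from this have "index_of w = [1]" using index_of_zword[of "[1]"] by simp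
    ultimately show ?thesis using True by simp
  next
    case False
    then have "u \<in> hC0" using u assms(2) by auto
    then obtain ls where ls: "ls \<noteq> []" "\<forall>l\<in>set ls. l \<ge> 1" "last ls \<ge> 2" "w = zword ls"
      using keys_hC0 w by blast
    then have "index_of w = ls" using index_of_zword by simp
    then show ?thesis using ls by auto
  qed
  \<comment> \<open>For each choice of one word per factor this is \<open>zeta_cyc_stuffle\<close>
    for the corresponding index.\<close>
  have pointwise: "(\<Sum>i<length us. \<Sum>p\<in>inner_terms (index_of (ws ! i)).
        ?\<phi> (ws[i := zword (inner_term k (index_of (ws ! i)) p)])) =
      (\<Sum>i<length us. ?\<phi> (insert_nth (Suc i) (zword [k]) ws))"
    if ws: "list_all2 (\<lambda>u w. w \<in> Poly_Mapping.keys u) us ws" for ws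
  proof -
    define kss where "kss = map index_of ws"
    have len: "length ws = length us" "length kss = length us"
      using ws by (simp_all add: kss_def list_all2_lengthD)
    have nth: "us ! i \<in> set us" "ws ! i \<in> Poly_Mapping.keys (us ! i)" "kss ! i = index_of (ws ! i)"
      if "i < length us" for i
      using that list_all2_nthD[OF ws that] len by (simp_all add: kss_def)
    have adm: "cyc_admissible kss"
      unfolding cyc_admissible_def
    proof (intro conjI ballI)
      fix ks assume "ks \<in> set kss"
      then obtain i where i: "i < length us" "ks = kss ! i"
        using len(2) by (metis in_set_conv_nth)
      from keys[OF nth(1,2)[OF i(1)]] show "ks \<noteq> []" "ks = [1] \<or> 2 \<le> last ks" "\<And>k. k \<in> set ks \<Longrightarrow> 1 \<le> k"
        by (auto simp: i(2) nth(3)[OF i(1)])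
    next
      \<comment> \<open>A factor other than \<open>yy\<close> lies in \<open>hC0\<close>, so
        whichever of its words is chosen, its index is not \<open>[1]\<close>.\<close>
      obtain i where i: "i < length us" "us ! i \<noteq> yy" using assms(3) by (metis in_set_conv_nth)
      then have "kss ! i \<noteq> [1]" using keys[OF nth(1,2)[OF i(1)]] nth(3) by simp
      then show "\<exists>ks\<in>set kss. ks \<noteq> [1]" using i(1) len(2) by (metis nth_mem)
    qed
    have index: "index_of (zword (inner_term k (index_of (ws ! i)) p)) = inner_term k (index_of (ws ! i)) p"
      if "i < length us" for i p
      using keys[OF nth(1,2)[OF that]] assms(4) by (intro index_of_zword inner_term_pos) auto
    have "(\<Sum>i<length us. \<Sum>p\<in>inner_terms (index_of (ws ! i)).
        ?\<phi> (ws[i := zword (inner_term k (index_of (ws ! i)) p)])) =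
        (\<Sum>i<length us. \<Sum>p\<in>inner_terms (kss ! i). zeta_cyc (kss[i := inner_term k (kss ! i) p]))"
      by (intro sum.cong refl) (simp_all add: nth(3) map_update index flip: kss_def)
    also have "\<dots> = (\<Sum>i<length kss.
        (\<Sum>j<length (kss ! i). zeta_cyc (kss[i := (kss ! i)[j := kss ! i ! j + k]])) +
        (\<Sum>j<length (kss ! i) - 1. zeta_cyc (kss[i := insert_nth (Suc j) k (kss ! i)])))"
      unfolding len(2) by (intro sum.cong refl sum_inner_terms)
    also have "\<dots> = (\<Sum>i<length kss. zeta_cyc (insert_nth (Suc i) [k] kss))"
      using adm assms(4) by (rule zeta_cyc_stuffle)
    also have "\<dots> = (\<Sum>i<length us. ?\<phi> (insert_nth (Suc i) (zword [k]) ws))"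
    proof -
      have "index_of (zword [k]) = [k]" using assms(4) by (intro index_of_zword) simp
      then show ?thesis by (simp add: map_insert_nth len(2) flip: kss_def)
    qed
    finally show ?thesis .
  qed
  have "Zcyc (tensor (take i us @ [inner_harmonic (zz k) (us ! i)] @ drop (Suc i) us)) =
      tlin us (\<lambda>ws. \<Sum>p\<in>inner_terms (index_of (ws ! i)).
        ?\<phi> (ws[i := zword (inner_term k (index_of (ws ! i)) p)]))" if i: "i < length us" for i
    unfolding Zcyc_tensor
    using keys[OF nth_mem[OF i]] assms(4) by (intro tlin_replace[OF i] lin_inner_harmonic) auto
  then have "(\<Sum>i<length us. Zcyc (tensor (take i us @ [inner_harmonic (zz k) (us ! i)] @ drop (Suc i) us)))
      = tlin us (\<lambda>ws. \<Sum>i<length us. \<Sum>p\<in>inner_terms (index_of (ws ! i)).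
        ?\<phi> (ws[i := zword (inner_term k (index_of (ws ! i)) p)]))"
    unfolding tlin_sum by (intro sum.cong) auto
  also have "\<dots> = tlin us (\<lambda>ws. \<Sum>i<length us. ?\<phi> (insert_nth (Suc i) (zword [k]) ws))"
    by (intro tlin_cong pointwise)
  also have "\<dots> = (\<Sum>i<length us. Zcyc (tensor (take (Suc i) us @ [zz k] @ drop (Suc i) us)))"
    unfolding tlin_sum Zcyc_tensor by (intro sum.cong refl tlin_insert_zz[symmetric]) simp
  finally have "(\<Sum>i<length us. Zcyc (tensor (take i us @ [inner_harmonic (zz k) (us ! i)] @ drop (Suc i) us)))
      = (\<Sum>i<length us. Zcyc (tensor (take (Suc i) us @ [zz k] @ drop (Suc i) us)))" .
  moreover have "inner_harmonic (zz k) (us ! i) = harmonic (zz k) (us ! i) - zz k * (us ! i) - (us ! i) * zz k"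
    if "i < length us" for i
    using assms(4) keys[OF nth_mem[OF that]] by (intro inner_harmonic_eq) auto
  ultimately show ?thesis by blast
qed

end
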